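(* Let $S\subseteq S_n$ with $|S|\le n-1$. The following are equivalent: (1) $S$ is symmetric. (2) One of the following holds: (a) $S\subseteq\{\iota_n,\delta_n\}$; (b) $S=\{\pi_1,\dots,\pi_{n-1}\}$ where either $\mathrm{Des}(\pi_i)=\{i\}$ for all $i$, or $\mathrm{Des}(\pi_i)=[n-1]\setminus\{i\}$ for all $i$; (c) $n=4$ and $S=\{\pi_1,\pi_2\}$ or $S=\{\pi_1,\pi_2,\iota_4\}$ or $S=\{\pi_1,\pi_2,\delta_4\}$, where $\mathrm{Des}(\pi_1)=\{1,3\}$ and $\mathrm{Des}(\pi_2)=\{2\}$; (d) $n=6$ and $S=\{\pi_1,\dots,\pi_5\}$ where either $\mathrm{Des}(\pi_1)=\{1,3,5\}$, $\mathrm{Des}(\pi_2)=\{2,5\}$, $\mathrm{Des}(\pi_3)=\{3\}$, $\mathrm{Des}(\pi_4)=\{1,4\}$, $\mathrm{Des}(\pi_5)=\{2,4\}$; or $\mathrm{Des}(\pi_1)=\{2,4\}$, $\mathrm{Des}(\pi_2)=\{1,3,4\}$, $\mathrm{Des}(\pi_3)=\{1,2,4,5\}$, $\mathrm{Des}(\pi_4)=\{2,3,5\}$, $\mathrm{Des}(\pi_5)=\{1,3,5\}$. (3) $S$ is Schur-positive.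
   Context: $S_n$ is the symmetric group on $[n]$; permutations in one-line notation. $\mathrm{Des}(w)=\{i\in[n-1]: w(i)>w(i+1)\}$. For $D\subseteq[n-1]$, $F_{n,D}=\sum x_{i_1}\cdots x_{i_n}$ over $i_1\le\cdots\le i_n$ with $i_j<i_{j+1}$ whenever $j\in D$. For $S\subseteq S_n$, $Q(S)=\sum_{w\in S}F_{n,\mathrm{Des}(w)}$. $S$ is symmetric if $Q(S)$ is a symmetric function, and Schur-positive if $Q(S)$ is a symmetric function whose expansion in the Schur basis has only nonnegative coefficients. $\iota_n=12\cdots n$, $\delta_n=n\cdots 21$. *)

theory Defs
  imports "HOL-Combinatorics.Permutations"
begin

definition Sn :: "nat \<Rightarrow> (nat \<Rightarrow> nat) set" where
  "Sn n = {w. w permutes {1..n}}"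

definition Des :: "nat \<Rightarrow> (nat \<Rightarrow> nat) \<Rightarrow> nat set" where
  "Des n w = {i \<in> {1..n-1}. w i > w (Suc i)}"

definition iota :: "nat \<Rightarrow> nat \<Rightarrow> nat" where
  "iota n = id"

definition delta :: "nat \<Rightarrow> nat \<Rightarrow> nat" where
  "delta n = (\<lambda>i. if i \<in> {1..n} then Suc n - i else i)"

text \<open>Formal power series (of bounded degree) in the variables x_1, x_2, ... are
  represented by their coefficient functions: a monomial x^alpha is given by its
  exponent vector alpha :: nat => nat (alpha k = exponent of x_k, k >= 1).\<close>

type_synonym qf = "(nat \<Rightarrow> nat) \<Rightarrow> int"

text \<open>Coefficient of x^alpha in F_{n,D}: the number of index sequences
  i_1 <= ... <= i_n of positive integers, strict at positions in D,
  with x_{i_1}...x_{i_n} = x^alpha.\<close>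

definition Fqs :: "nat \<Rightarrow> nat set \<Rightarrow> qf" where
  "Fqs n D \<alpha> = int (card {i :: nat \<Rightarrow> nat.
      (\<forall>j \<in> {1..n}. 1 \<le> i j) \<and>
      (\<forall>j. j \<notin> {1..n} \<longrightarrow> i j = 0) \<and>
      (\<forall>j \<in> {1..n-1}. i j \<le> i (Suc j)) \<and>
      (\<forall>j \<in> D. i j < i (Suc j)) \<and>
      (\<forall>k. card {j \<in> {1..n}. i j = k} = \<alpha> k)})"

definition Qgen :: "nat \<Rightarrow> (nat \<Rightarrow> nat) set \<Rightarrow> qf" where
  "Qgen n S \<alpha> = (\<Sum>w\<in>S. Fqs n (Des n w) \<alpha>)"

definition symmetric_fn :: "qf \<Rightarrow> bool" where
  "symmetric_fn f \<longleftrightarrow> (\<forall>\<sigma> \<alpha>. \<sigma> permutes {1..} \<longrightarrow> f (\<alpha> \<circ> \<sigma>) = f \<alpha>)"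

definition is_partition :: "nat \<Rightarrow> nat list \<Rightarrow> bool" where
  "is_partition n lam \<longleftrightarrow> sorted_wrt (\<ge>) lam \<and> 0 \<notin> set lam \<and> sum_list lam = n"

definition cells :: "nat list \<Rightarrow> (nat \<times> nat) set" where
  "cells lam = {(r, c). r < length lam \<and> c < lam ! r}"

definition is_SSYT :: "nat list \<Rightarrow> (nat \<times> nat \<Rightarrow> nat) \<Rightarrow> bool" where
  "is_SSYT lam T \<longleftrightarrow>
     (\<forall>x. x \<notin> cells lam \<longrightarrow> T x = 0) \<and>
     (\<forall>x \<in> cells lam. 1 \<le> T x) \<and>
     (\<forall>r c. (r, Suc c) \<in> cells lam \<longrightarrow> T (r, c) \<le> T (r, Suc c)) \<and>
     (\<forall>r c. (Suc r, c) \<in> cells lam \<longrightarrow> T (r, c) < T (Suc r, c))"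

definition schur :: "nat list \<Rightarrow> qf" where
  "schur lam \<alpha> = int (card {T. is_SSYT lam T \<and>
       (\<forall>k. card {x \<in> cells lam. T x = k} = \<alpha> k)})"

definition schur_positive :: "nat \<Rightarrow> qf \<Rightarrow> bool" where
  "schur_positive n f \<longleftrightarrow> symmetric_fn f \<and>
     (\<exists>c :: nat list \<Rightarrow> int. (\<forall>lam. 0 \<le> c lam) \<and>
        (\<forall>\<alpha>. f \<alpha> = (\<Sum>lam\<in>{lam. is_partition n lam}. c lam * schur lam \<alpha>)))"

end

theory Submission
  imports Defs
begin

text \<open>The coefficient of \<open>x\<^sup>\<alpha>\<close> in \<open>Q(S)\<close> counts the \<open>w \<in> S\<close> whose descents are partial sums of \<open>\<alpha>\<close>, so
  symmetry of \<open>S\<close> says that this count does not change when adjacent blocks of a composition are swapped.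
  This condition survives complementing all descent sets (inclusion-exclusion), discarding the descent
  sets \<open>{}\<close> and \<open>{1..<n}\<close>, and passing to the descent sets that contain 1, with \<open>{1, 2}\<close> cut off
  (the operator adjoint to multiplication by \<open>e\<^sub>2\<close>).

  If the descent set \<open>{1}\<close> occurs, swaps in three-part compositions produce, for each \<open>i\<close>, a
  descent set \<open>{i}\<close> or \<open>{i, i + 1}\<close>; there is room for only \<open>n - 1\<close> of them, which forces all of them to be
  singletons. Otherwise, and if also \<open>{2..<n}\<close> does not occur, for \<open>n \<ge> 7\<close> one of the families \<open>1 \<in> D\<close>,
  \<open>1 \<notin> D\<close> has at most \<open>(n - 1) div 2 \<le> n - 4\<close> members, so its restriction to \<open>n - 2\<close> is trivial by induction,
  and then the whole family is empty. The cases \<open>n \<le> 6\<close> are linear algebra in the multiplicities of the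
  descent sets. Conversely, each family in the list is the descent family of the standard tableaux of
  one or two fixed shapes, so \<open>Q(S)\<close> is a sum of Schur functions.\<close>

section \<open>Symmetric families of descent sets\<close>

text \<open>For symmetric Q(S), counting the members with \<open>d w \<subseteq> V\<close> is
  pairing Q(S) with the complete homogeneous function h of the composition whose partial sums form
  V. The classification works with these counts alone, so no Schur expansion of an unknown function
  is needed. In this language complementing descent sets is the involution omega, and the
  restriction is adjoint to e_2 because e_2 = h_1^2 - h_2: it subtracts the count for (2, \<beta>)
  from that for (1, 1, \<beta>). The induction descends by two, so each parity needs a base. The
  even base cannot be 4: the descent sets {2} and {1, 3} of shape (2, 2) form a nontrivial family
  there, with 2 = 6 - 4 members, exactly the size allowed to a restriction from n = 6. This is why 6
  is solved by hand, and families of shapes (3, 3) and (2, 2, 2) do appear there. In the converse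
  direction Schur-positivity includes symmetry by definition, so the Schur functions in use must be
  shown symmetric. This is done on their descent sets, by counting parts or by a finite check over
  compositions.\<close>

definition rot :: "nat \<Rightarrow> nat \<Rightarrow> nat \<Rightarrow> nat \<Rightarrow> nat" where
  "rot p q r j = (if p < j \<and> j \<le> q then j + (r - q) else if q < j \<and> j \<le> r then j - (q - p) else j)"

definition symfam :: "nat \<Rightarrow> 'a set \<Rightarrow> ('a \<Rightarrow> nat set) \<Rightarrow> bool" where
  "symfam n S d \<longleftrightarrow> finite S \<and> (\<forall>w\<in>S. d w \<subseteq> {1..<n}) \<and>
     (\<forall>p q r V. p < q \<longrightarrow> q < r \<longrightarrow> r \<le> n \<longrightarrow> V \<subseteq> {1..n} \<longrightarrow> n \<in> V \<longrightarrow> p \<in> insert 0 V \<longrightarrow> q \<in> V \<longrightarrow> r \<in> V \<longrightarrow>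
        card {w \<in> S. d w \<subseteq> rot p q r ` V} = card {w \<in> S. d w \<subseteq> V})"

lemma symfamD:
  assumes "symfam n S d"
  shows "finite S" "\<And>w. w \<in> S \<Longrightarrow> d w \<subseteq> {1..<n}"
    "\<And>p q r V. \<lbrakk>p < q; q < r; r \<le> n; V \<subseteq> {1..n}; n \<in> V; p \<in> insert 0 V; q \<in> V; r \<in> V\<rbrakk> \<Longrightarrow>
       card {w \<in> S. d w \<subseteq> rot p q r ` V} = card {w \<in> S. d w \<subseteq> V}"
  using assms unfolding symfam_def by blast+

text \<open>\<open>rot\<close> exchanges the blocks (p, q] and (q, r] by translations; with closed
  right ends it carries partial sums to partial sums. After the exchange the inner cut lies at p + r
  - q, so exchanging there undoes it.\<close>

lemma rot_inverse:
  assumes "p \<le> q" "q \<le> r"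
  shows "rot p (p + r - q) r (rot p q r j) = j"
  using assms unfolding rot_def by auto

lemma inj_rot:
  assumes "p \<le> q" "q \<le> r"
  shows "inj (rot p q r)"
  by (rule inj_on_inverseI[where g = "rot p (p + r - q) r"]) (rule rot_inverse[OF assms])

lemma rot_image_interval:
  assumes "p \<le> q" "q \<le> r" "r \<le> n"
  shows "rot p q r ` {1..n} = {1..n}"
proof (rule card_seteq)
  show "rot p q r ` {1..n} \<subseteq> {1..n}" using assms unfolding rot_def by auto
  show "card {1..n} \<le> card (rot p q r ` {1..n})"
    using card_image[OF inj_on_subset[OF inj_rot[OF assms(1,2)]], of "{1..n}"] by simp
qed simp

text \<open>If r = n, then n is the image of q, the right end of the block moved to the top;
  otherwise n is fixed.\<close>

lemma rot_mem_top:
  assumes "p < q" "q < r" "r \<le> n" "n \<in> V" "q \<in> V"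
  shows "n \<in> rot p q r ` V"
proof (cases "r = n")
  case True
  have "rot p q r q = n" using assms True unfolding rot_def by auto
  then show ?thesis using assms by (metis imageI)
next
  case False
  have "rot p q r n = n" using assms False unfolding rot_def by auto
  then show ?thesis using assms by (metis imageI)
qed

section \<open>Inclusion-exclusion and complements of descent sets\<close>

lemma alternating_sum_subsets:
  assumes "finite X"
  shows "(\<Sum>V\<in>Pow X. (- 1) ^ card V) = (if X = {} then 1 else 0 :: int)"
  using prod_diff_conv_sum[OF assms, of "\<lambda>_. 1" "\<lambda>_. 1 :: int"] assms by (simp add: card_eq_0_iff power_0_left)

lemma alternating_sum_supersets:
  assumes "D \<subseteq> {1..n}"
  shows "(\<Sum>V | D \<subseteq> V \<and> V \<subseteq> {1..n}. (- 1) ^ (n - card V)) = (if D = {1..n} then 1 else 0 :: int)"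
proof -
  have "(\<Sum>V | D \<subseteq> V \<and> V \<subseteq> {1..n}. (- 1) ^ (n - card V)) = (\<Sum>U\<in>Pow ({1..n} - D). (- 1) ^ card U :: int)"
  proof (rule sum.reindex_bij_witness[where i = "\<lambda>U. {1..n} - U" and j = "\<lambda>V. {1..n} - V"])
    fix V assume "V \<in> {V. D \<subseteq> V \<and> V \<subseteq> {1..n}}"
    then have "card ({1..n} - V) = n - card V"
      by (subst card_Diff_subset) (auto intro: finite_subset)
    then show "(- 1) ^ card ({1..n} - V) = ((- 1) ^ (n - card V) :: int)" by simp
  qed (use assms in auto)
  also have "\<dots> = (if {1..n} - D = {} then 1 else 0)" by (rule alternating_sum_subsets) simp
  finally show ?thesis using assms by auto
qed

lemma card_as_sum:
  assumes "finite S"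
  shows "int (card {w \<in> S. P w}) = (\<Sum>w\<in>S. if P w then 1 else 0)"
  using assms by (simp add: sum.If_cases Int_def)

text \<open>The complement of \<open>d w\<close> lies in \<open>T\<close> exactly when
  \<open>d w\<close> and \<open>T\<close> together cover \<open>{1..n}\<close>. The indicator of
  this event is an alternating sum over the sets above \<open>d w \<union> T\<close>, and exchanging
  the two sums gives the formula. The point n, absent from \<open>{1..<n}\<close>, is supplied by
  \<open>T\<close>.\<close>

lemma card_complement_subset:
  assumes fin: "finite S" and d: "\<And>w. w \<in> S \<Longrightarrow> d w \<subseteq> {1..<n}" and T: "T \<subseteq> {1..n}" "n \<in> T"
  shows "int (card {w \<in> S. {1..<n} - d w \<subseteq> T}) =
    (\<Sum>V | T \<subseteq> V \<and> V \<subseteq> {1..n}. (- 1) ^ (n - card V) * int (card {w \<in> S. d w \<subseteq> V}))"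
proof -
  have "(\<Sum>V | T \<subseteq> V \<and> V \<subseteq> {1..n}. (- 1) ^ (n - card V) * int (card {w \<in> S. d w \<subseteq> V}))
     = (\<Sum>V | T \<subseteq> V \<and> V \<subseteq> {1..n}. \<Sum>w\<in>S. if d w \<subseteq> V then (- 1) ^ (n - card V) else 0)"
    unfolding card_as_sum[OF fin] sum_distrib_left by (intro sum.cong) auto
  also have "\<dots> = (\<Sum>w\<in>S. \<Sum>V | T \<subseteq> V \<and> V \<subseteq> {1..n}. if d w \<subseteq> V then (- 1) ^ (n - card V) else 0)"
    by (rule sum.swap)
  also have "\<dots> = (\<Sum>w\<in>S. if {1..<n} - d w \<subseteq> T then 1 else 0)"
  proof (rule sum.cong[OF refl])
    fix w assume w: "w \<in> S"
    have "(\<Sum>V | T \<subseteq> V \<and> V \<subseteq> {1..n}. if d w \<subseteq> V then (- 1) ^ (n - card V) else 0)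
      = (\<Sum>V | d w \<union> T \<subseteq> V \<and> V \<subseteq> {1..n}. (- 1) ^ (n - card V) :: int)"
      by (rule sum.mono_neutral_cong_right) auto
    also have "\<dots> = (if d w \<union> T = {1..n} then 1 else 0)"
      using d[OF w] T by (intro alternating_sum_supersets) fastforce
    also have "(d w \<union> T = {1..n}) \<longleftrightarrow> {1..<n} - d w \<subseteq> T"
    proof -
      have ins: "{1..n} = insert n {1..<n}" using T by auto
      show ?thesis using d[OF w] T unfolding ins by blast
    qed
    finally show "(\<Sum>V | T \<subseteq> V \<and> V \<subseteq> {1..n}. if d w \<subseteq> V then (- 1) ^ (n - card V) else 0)
      = (if {1..<n} - d w \<subseteq> T then 1 else 0 :: int)" .
  qed
  finally show ?thesis unfolding card_as_sum[OF fin] by simp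
qed

text \<open>Every superset of \<open>V\<close> still has the cuts p, q, r, so the swap leaves each
  term of the inclusion-exclusion formula unchanged, and \<open>rot\<close> maps the supersets of
  \<open>V\<close> bijectively onto those of its image.\<close>

lemma symfam_complement:
  assumes sf: "symfam n S d"
  shows "symfam n S (\<lambda>w. {1..<n} - d w)"
  unfolding symfam_def
proof (intro conjI allI impI)
  note D = symfamD[OF sf]
  show "finite S" by (rule D)
  show "\<forall>w\<in>S. {1..<n} - d w \<subseteq> {1..<n}" by blast
  fix p q r V
  assume A: "p < q" "q < r" "r \<le> n" "V \<subseteq> {1..n}" "n \<in> V" "p \<in> insert 0 V" "q \<in> V" "r \<in> V"
  define \<rho> where "\<rho> = rot p q r"
  define \<rho>' where "\<rho>' = rot p (p + r - q) r"
  have le: "p \<le> q" "q \<le> r" using A by auto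
  have inj: "inj \<rho>" unfolding \<rho>_def by (rule inj_rot[OF le])
  have img: "\<rho> ` {1..n} = {1..n}" unfolding \<rho>_def by (rule rot_image_interval) (use A in auto)
  have V': "\<rho> ` V \<subseteq> {1..n}" using A(4) img by blast
  have n': "n \<in> \<rho> ` V" unfolding \<rho>_def by (rule rot_mem_top) (use A in auto)
  have inv1: "\<rho>' (\<rho> j) = j" for j unfolding \<rho>_def \<rho>'_def by (rule rot_inverse[OF le])
  have inv2: "\<rho> (\<rho>' j) = j" for j
    using rot_inverse[of p "p + r - q" r j] le unfolding \<rho>_def \<rho>'_def by simp
  have img': "\<rho>' ` {1..n} = {1..n}"
  proof -
    have "\<rho>' ` \<rho> ` {1..n} = {1..n}" by (simp add: image_image inv1)
    then show ?thesis unfolding img .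
  qed
  have "(\<Sum>U | V \<subseteq> U \<and> U \<subseteq> {1..n}. (- 1) ^ (n - card U) * int (card {w \<in> S. d w \<subseteq> U}))
     = (\<Sum>U | \<rho> ` V \<subseteq> U \<and> U \<subseteq> {1..n}. (- 1) ^ (n - card U) * int (card {w \<in> S. d w \<subseteq> U}))"
  proof (rule sum.reindex_bij_witness[where i = "image \<rho>'" and j = "image \<rho>"])
    fix U assume "U \<in> {U. V \<subseteq> U \<and> U \<subseteq> {1..n}}"
    then have U: "V \<subseteq> U" "U \<subseteq> {1..n}" by auto
    show "\<rho>' ` \<rho> ` U = U" by (simp add: image_image inv1)
    show "\<rho> ` U \<in> {U. \<rho> ` V \<subseteq> U \<and> U \<subseteq> {1..n}}" using U img by blast
    have "card (\<rho> ` U) = card U" by (meson card_image inj inj_on_subset subset_UNIV)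
    moreover have "card {w \<in> S. d w \<subseteq> \<rho> ` U} = card {w \<in> S. d w \<subseteq> U}"
      unfolding \<rho>_def by (rule D(3)) (use A U in auto)
    ultimately show "(- 1) ^ (n - card (\<rho> ` U)) * int (card {w \<in> S. d w \<subseteq> \<rho> ` U}) =
       (- 1) ^ (n - card U) * int (card {w \<in> S. d w \<subseteq> U})" by simp
  next
    fix U assume "U \<in> {U. \<rho> ` V \<subseteq> U \<and> U \<subseteq> {1..n}}"
    then have U: "\<rho> ` V \<subseteq> U" "U \<subseteq> {1..n}" by auto
    show "\<rho> ` \<rho>' ` U = U" by (simp add: image_image inv2)
    have "\<rho>' ` \<rho> ` V \<subseteq> \<rho>' ` U" using U by blast
    then have "V \<subseteq> \<rho>' ` U" by (simp add: image_image inv1)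
    then show "\<rho>' ` U \<in> {U. V \<subseteq> U \<and> U \<subseteq> {1..n}}" using U img' by blast
  qed
  then show "card {w \<in> S. {1..<n} - d w \<subseteq> rot p q r ` V} = card {w \<in> S. {1..<n} - d w \<subseteq> V}"
    using card_complement_subset[where d = d, OF D(1) D(2) A(4,5)] card_complement_subset[where d = d, OF D(1) D(2) V' n']
    unfolding \<rho>_def by simp
qed

text \<open>The set \<open>{}\<close> lies in every \<open>V\<close>, and \<open>{1..<n}\<close>
  only in \<open>V = {1..n}\<close>, which swaps preserve; so the discarded members contribute
  equally to both sides.\<close>

lemma symfam_remove:
  assumes sf: "symfam n S d" and E: "E = {} \<or> E = {1..<n}"
  shows "symfam n {w \<in> S. d w \<noteq> E} d"
  unfolding symfam_def
proof (intro conjI allI impI)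
  note D = symfamD[OF sf]
  show "finite {w \<in> S. d w \<noteq> E}" using D(1) by simp
  show "\<forall>w\<in>{w \<in> S. d w \<noteq> E}. d w \<subseteq> {1..<n}" using D(2) by blast
  have split: "card {w \<in> S. d w \<subseteq> U} = card {w \<in> {w \<in> S. d w \<noteq> E}. d w \<subseteq> U} + (if E \<subseteq> U then card {w \<in> S. d w = E} else 0)" for U
  proof (cases "E \<subseteq> U")
    case True
    then have "{w \<in> S. d w \<subseteq> U} = {w \<in> {w \<in> S. d w \<noteq> E}. d w \<subseteq> U} \<union> {w \<in> S. d w = E}" by auto
    then show ?thesis using True D(1) by (simp add: card_Un_disjoint disjoint_iff)
  next
    case False
    then have "{w \<in> S. d w \<subseteq> U} = {w \<in> {w \<in> S. d w \<noteq> E}. d w \<subseteq> U}" by auto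
    then show ?thesis using False by simp
  qed
  fix p q r V
  assume A: "p < q" "q < r" "r \<le> n" "V \<subseteq> {1..n}" "n \<in> V" "p \<in> insert 0 V" "q \<in> V" "r \<in> V"
  have img: "rot p q r ` {1..n} = {1..n}" by (rule rot_image_interval) (use A in auto)
  have inj: "inj (rot p q r)" by (rule inj_rot) (use A in auto)
  have n': "n \<in> rot p q r ` V" by (rule rot_mem_top) (use A in auto)
  have "E \<subseteq> rot p q r ` V \<longleftrightarrow> E \<subseteq> V"
  proof (cases "E = {}")
    case False
    then have E: "E = {1..<n}" using E by blast
    have ins: "{1..n} = insert n {1..<n}" using A by auto
    have "E \<subseteq> rot p q r ` V \<longleftrightarrow> {1..n} \<subseteq> rot p q r ` V" unfolding ins E using n' by blast
    also have "\<dots> \<longleftrightarrow> {1..n} \<subseteq> V"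
      using img inj by (metis inj_image_subset_iff)
    also have "\<dots> \<longleftrightarrow> E \<subseteq> V" unfolding ins E using A by blast
    finally show ?thesis .
  qed simp
  then show "card {w \<in> {w \<in> S. d w \<noteq> E}. d w \<subseteq> rot p q r ` V} = card {w \<in> {w \<in> S. d w \<noteq> E}. d w \<subseteq> V}"
    using split[of V] split[of "rot p q r ` V"] D(3)[OF A] by simp
qed

text \<open>If \<open>U\<close> consists of the partial sums of \<beta>, the members that contain 1
  and restrict into \<open>U\<close> are those counted for (1, 1, \<beta>) but not for (2, \<beta>).
  Swaps inside \<beta> preserve both counts.\<close>

lemma symfam_restrict:
  assumes sf: "symfam n S d" and n: "3 \<le> n"
  shows "symfam (n - 2) {w \<in> S. 1 \<in> d w} (\<lambda>w. (\<lambda>j. j - 2) ` (d w - {1, 2}))"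
  unfolding symfam_def
proof (intro conjI allI impI)
  note D = symfamD[OF sf]
  define S1 where "S1 = {w \<in> S. 1 \<in> d w}"
  define d1 where "d1 = (\<lambda>w. (\<lambda>j. j - 2) ` (d w - {1, 2}))"
  show "finite {w \<in> S. 1 \<in> d w}" using D(1) by simp
  show "\<forall>w\<in>{w \<in> S. 1 \<in> d w}. (\<lambda>j. j - 2) ` (d w - {1, 2}) \<subseteq> {1..<n - 2}"
    using D(2) by fastforce
  have key: "card {w \<in> S. d w \<subseteq> {1, 2} \<union> (+) 2 ` U} = card {w \<in> S1. d1 w \<subseteq> U} + card {w \<in> S. d w \<subseteq> {2} \<union> (+) 2 ` U}"
    if "0 \<notin> U" for U
  proof -
    have d1_iff: "d1 w \<subseteq> U \<longleftrightarrow> d w \<subseteq> {1, 2} \<union> (+) 2 ` U" if w: "w \<in> S" for w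
    proof
      assume a: "d1 w \<subseteq> U"
      show "d w \<subseteq> {1, 2} \<union> (+) 2 ` U"
      proof
        fix j assume j: "j \<in> d w"
        show "j \<in> {1, 2} \<union> (+) 2 ` U"
        proof (cases "j \<in> {1, 2}")
          case False
          have "j - 2 \<in> U" using a j False unfolding d1_def by blast
          moreover have "j = 2 + (j - 2)" using D(2)[OF w] j False by fastforce
          ultimately show ?thesis by blast
        qed blast
      qed
    next
      assume a: "d w \<subseteq> {1, 2} \<union> (+) 2 ` U"
      show "d1 w \<subseteq> U"
      proof
        fix i assume "i \<in> d1 w"
        then obtain j where j: "j \<in> d w" "j \<notin> {1, 2}" "i = j - 2" unfolding d1_def by blast
        then have "j \<in> (+) 2 ` U" using a by blast
        then show "i \<in> U" using j(3) by auto
      qed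
    qed
    have one: "1 \<notin> {2} \<union> (+) 2 ` U" using that by auto
    have "{w \<in> S. d w \<subseteq> {1, 2} \<union> (+) 2 ` U} = {w \<in> S1. d1 w \<subseteq> U} \<union> {w \<in> S. d w \<subseteq> {2} \<union> (+) 2 ` U}" (is "?A = ?B \<union> ?C")
      using one d1_iff unfolding S1_def by blast
    moreover have "?B \<inter> ?C = {}" using one unfolding S1_def by blast
    ultimately show ?thesis using D(1) unfolding S1_def by (simp add: card_Un_disjoint)
  qed
  fix p q r V
  assume A: "p < q" "q < r" "r \<le> n - 2" "V \<subseteq> {1..n - 2}" "n - 2 \<in> V" "p \<in> insert 0 V" "q \<in> V" "r \<in> V"
  have sh: "rot (2 + p) (2 + q) (2 + r) ` (B \<union> (+) 2 ` V) = B \<union> (+) 2 ` rot p q r ` V" if "B \<subseteq> {1, 2}" for B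
  proof -
    have "rot (2 + p) (2 + q) (2 + r) ` B = B"
    proof -
      have "\<And>j. j \<in> B \<Longrightarrow> rot (2 + p) (2 + q) (2 + r) j = j" using that unfolding rot_def by auto
      then show ?thesis by simp
    qed
    moreover have "rot (2 + p) (2 + q) (2 + r) (2 + j) = 2 + rot p q r j" for j
      unfolding rot_def by auto
    ultimately show ?thesis by (simp add: image_Un image_image)
  qed
  \<comment> \<open>2 must lie in \<open>B\<close> because the cut p = 0 of the restricted
    composition becomes the cut 2.\<close>
  have inv: "card {w \<in> S. d w \<subseteq> B \<union> (+) 2 ` rot p q r ` V} = card {w \<in> S. d w \<subseteq> B \<union> (+) 2 ` V}"
    if "B \<subseteq> {1, 2}" "2 \<in> B" for B
  proof (subst sh[OF that(1), symmetric], rule D(3))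
    show "n \<in> B \<union> (+) 2 ` V"
    proof -
      have "n = 2 + (n - 2)" using n by simp
      then show ?thesis using A(5) by blast
    qed
    show "B \<union> (+) 2 ` V \<subseteq> {1..n}" using that(1) n A(4) by fastforce
    show "2 + p \<in> insert 0 (B \<union> (+) 2 ` V)" by (cases "p = 0") (use that(2) A(6) in auto)
  qed (use A in auto)
  have z: "0 \<notin> V" "0 \<notin> rot p q r ` V" using A(4) A(1,2) unfolding rot_def by auto
  show "card {w \<in> {w \<in> S. 1 \<in> d w}. (\<lambda>j. j - 2) ` (d w - {1, 2}) \<subseteq> rot p q r ` V} =
        card {w \<in> {w \<in> S. 1 \<in> d w}. (\<lambda>j. j - 2) ` (d w - {1, 2}) \<subseteq> V}"
    using key[OF z(1)] key[OF z(2)] inv[of "{2}"] inv[of "{1,2}"]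
    unfolding S1_def d1_def by simp
qed

section \<open>Classification of small families\<close>

definition dcount :: "'a set \<Rightarrow> ('a \<Rightarrow> nat set) \<Rightarrow> nat set \<Rightarrow> nat" where
  "dcount S d D = card {w \<in> S. d w = D}"

text \<open>Counts over an interval of the Boolean lattice. Splitting the interval by one element at
  a time expands the count for \<open>d w \<subseteq> V\<close> into multiplicities of single
  descent sets, which turns every swap into a linear equation.\<close>

definition between :: "'a set \<Rightarrow> ('a \<Rightarrow> nat set) \<Rightarrow> nat set \<Rightarrow> nat set \<Rightarrow> nat" where
  "between S d E T = card {w \<in> S. E \<subseteq> d w \<and> d w \<subseteq> E \<union> T}"

lemma between_empty: "between S d E {} = dcount S d E"
  unfolding between_def dcount_def by (rule arg_cong[where f = card]) auto

lemma between_insert: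
  assumes "finite S" "x \<notin> E" "x \<notin> T"
  shows "between S d E (insert x T) = between S d E T + between S d (insert x E) T"
proof -
  have "{w \<in> S. E \<subseteq> d w \<and> d w \<subseteq> E \<union> insert x T} =
    {w \<in> S. E \<subseteq> d w \<and> d w \<subseteq> E \<union> T} \<union> {w \<in> S. insert x E \<subseteq> d w \<and> d w \<subseteq> insert x E \<union> T}" (is "_ = ?B \<union> ?C")
    using assms by auto
  moreover have "?B \<inter> ?C = {}" using assms by auto
  ultimately show ?thesis unfolding between_def using assms(1) by (simp add: card_Un_disjoint)
qed

lemma symfam_between:
  assumes sf: "symfam n S d" and "p < q" "q < r" "r \<le> n" "V \<subseteq> {1..n}" "n \<in> V" "p \<in> insert 0 V" "q \<in> V" "r \<in> V"
  shows "between S d {} (rot p q r ` V - {n}) = between S d {} (V - {n})"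
proof -
  have "between S d {} (U - {n}) = card {w \<in> S. d w \<subseteq> U}" for U
  proof -
    have "\<And>w. w \<in> S \<Longrightarrow> n \<notin> d w" using symfamD(2)[OF sf] by fastforce
    then show ?thesis unfolding between_def by (intro arg_cong[where f = card]) blast
  qed
  then show ?thesis using symfamD(3)[OF assms] by simp
qed

locale proper_symfam =
  fixes n :: nat and S :: "'a set" and d :: "'a \<Rightarrow> nat set"
  assumes sf: "symfam n S d"
    and proper: "\<And>w. w \<in> S \<Longrightarrow> d w \<noteq> {}" "\<And>w. w \<in> S \<Longrightarrow> d w \<noteq> {1..<n}"
begin

abbreviation a where "a \<equiv> dcount S d"

lemma fin: "finite S" using symfamD(1)[OF sf] .

lemma d_subset: "w \<in> S \<Longrightarrow> d w \<subseteq> {1..<n}" using symfamD(2)[OF sf] .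

lemma a_eq_0: "(\<And>w. w \<in> S \<Longrightarrow> d w \<noteq> D) \<Longrightarrow> a D = 0"
  unfolding dcount_def by (auto simp: card_eq_0_iff)

lemma a_pos: "0 < a D \<Longrightarrow> \<exists>w\<in>S. d w = D"
  using a_eq_0[of D] by fastforce

lemma a_0D: "a D = 0 \<Longrightarrow> w \<in> S \<Longrightarrow> d w \<noteq> D"
  using fin unfolding dcount_def by (auto simp: card_eq_0_iff)

lemma a_empty: "a {} = 0" "a {1..<n} = 0"
  using proper by (auto intro: a_eq_0)

text \<open>Exchange of the two parts of (i, n - i); the empty descent set cancels.\<close>

lemma swap2:
  assumes "1 \<le> i" "i < n"
  shows "a {i} = a {n - i}"
proof -
  have "between S d {} (rot 0 i n ` {i, n} - {n}) = between S d {} ({i, n} - {n})"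
    by (rule symfam_between[OF sf]) (use assms in auto)
  moreover have "rot 0 i n ` {i, n} - {n} = {n - i}" "{i, n} - {n} = {i}"
    using assms unfolding rot_def by auto
  ultimately show ?thesis using fin by (simp add: between_insert between_empty)
qed

text \<open>Exchange of the first two parts of (x, y, n - x - y); the terms for \<open>{}\<close>
  and for the common cut x + y cancel.\<close>

lemma swap3_first:
  assumes "1 \<le> x" "1 \<le> y" "x + y < n"
  shows "a {x} + a {x, x + y} = a {y} + a {y, x + y}"
proof -
  have "between S d {} (rot 0 x (x + y) ` {x, x + y, n} - {n}) = between S d {} ({x, x + y, n} - {n})"
    by (rule symfam_between[OF sf]) (use assms in auto)
  moreover have "rot 0 x (x + y) ` {x, x + y, n} - {n} = {y, x + y}" "{x, x + y, n} - {n} = {x, x + y}"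
    using assms unfolding rot_def by auto
  ultimately show ?thesis using fin assms by (simp add: between_insert between_empty insert_commute)
qed

text \<open>Exchange of the last two parts of (p, q - p, n - q); the terms for \<open>{}\<close> and
  for the common cut p cancel.\<close>

lemma swap3_last:
  assumes "1 \<le> p" "p < q" "q < n"
  shows "a {q} + a {p, q} = a {p + n - q} + a {p, p + n - q}"
proof -
  have "between S d {} (rot p q n ` {p, q, n} - {n}) = between S d {} ({p, q, n} - {n})"
    by (rule symfam_between[OF sf]) (use assms in auto)
  moreover have "rot p q n ` {p, q, n} - {n} = {p, p + n - q}" "{p, q, n} - {n} = {p, q}"
    using assms unfolding rot_def by auto
  ultimately show ?thesis using fin assms by (simp add: between_insert between_empty insert_commute)
qed

lemma sum_a_le:
  assumes "finite I" "inj_on D I"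
  shows "(\<Sum>i\<in>I. a (D i)) \<le> card S"
proof -
  have "(\<Sum>i\<in>I. a (D i)) = card (\<Union>i\<in>I. {w \<in> S. d w = D i})"
    unfolding dcount_def
    by (rule card_UN_disjoint[symmetric]) (use assms fin in \<open>auto dest: inj_onD\<close>)
  also have "\<dots> \<le> card S" by (rule card_mono[OF fin]) auto
  finally show ?thesis .
qed

lemma complement: "proper_symfam n S (\<lambda>w. {1..<n} - d w)"
proof
  show "symfam n S (\<lambda>w. {1..<n} - d w)" by (rule symfam_complement[OF sf])
  fix w assume w: "w \<in> S"
  then show "{1..<n} - d w \<noteq> {}" "{1..<n} - d w \<noteq> {1..<n}"
    using proper[OF w] d_subset[OF w] by blast+
qed

lemma dcount_complement: "D \<subseteq> {1..<n} \<Longrightarrow> dcount S (\<lambda>w. {1..<n} - d w) D = a ({1..<n} - D)"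
  unfolding dcount_def using d_subset by (intro arg_cong[where f = card]) blast

section \<open>Families containing the descent set {1}\<close>

lemma all_singletons:
  assumes n: "2 \<le> n" and card: "card S \<le> n - 1" and one: "a {1} \<noteq> 0" and i: "i \<in> {1..<n}"
  shows "a {i} \<noteq> 0"
proof -
  have a_last: "a {n - 1} = a {1}" using swap2[of 1] n by simp
  \<comment> \<open>\<open>f i\<close> counts the members with descent set {i} or {i, i + 1}; at i =
    n - 1 the second set would contain n and is left out.\<close>
  define f where "f = (\<lambda>i. a {i} + (if i < n - 1 then a {i, Suc i} else 0))"
  have ge1: "1 \<le> f i" if "i \<in> {1..<n}" for i
  proof (cases "i = 1 \<or> i = n - 1")
    case True
    then show ?thesis using one a_last unfolding f_def by auto
  next
    case False
    then have "a {1} + a {1, Suc i} = a {i} + a {i, Suc i}" using swap3_first[of 1 i] that by (simp; linarith)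
    then show ?thesis using False that one unfolding f_def by auto
  qed
  have sum_le: "(\<Sum>i\<in>{1..<n}. f i) \<le> n - 1"
  proof -
    \<comment> \<open>Singletons and consecutive pairs are distinct sets, so their multiplicities
      together are bounded by the size of \<open>S\<close>. Then n - 1 values of \<open>f\<close>,
      each at least 1, have sum at most n - 1, so all equal 1.\<close>
    define I where "I = (\<lambda>i. (i, True)) ` {1..<n} \<union> (\<lambda>i. (i, False)) ` {1..<n - 1}"
    define D where "D = (\<lambda>(i :: nat, b). if b then {i} else {i, Suc i})"
    have "inj_on D I" unfolding inj_on_def I_def D_def by (auto simp: doubleton_eq_iff)
    then have "(\<Sum>i\<in>I. a (D i)) \<le> card S" by (intro sum_a_le) (simp_all add: I_def)
    moreover have "(\<Sum>i\<in>I. a (D i)) = (\<Sum>i\<in>{1..<n}. a {i}) + (\<Sum>i\<in>{1..<n - 1}. a {i, Suc i})"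
      unfolding I_def by (subst sum.union_disjoint) (auto simp: sum.reindex inj_on_def D_def)
    moreover have "(\<Sum>i\<in>{1..<n - 1}. a {i, Suc i}) = (\<Sum>i\<in>{1..<n}. if i < n - 1 then a {i, Suc i} else 0)"
      by (rule sum.mono_neutral_cong_left) auto
    ultimately show ?thesis using card unfolding f_def by (simp add: sum.distrib)
  qed
  have eq1: "f i = 1" if i: "i \<in> {1..<n}" for i
  proof (rule ccontr)
    assume "f i \<noteq> 1"
    then have "1 < f i" using ge1[OF i] by simp
    then have "(\<Sum>i\<in>{1..<n}. 1) < (\<Sum>i\<in>{1..<n}. f i)"
      by (intro sum_strict_mono_ex1) (use ge1 i in auto)
    then show False using sum_le by simp
  qed
  \<comment> \<open>A missing {i} propagates to {i + 1}. By reflection {n - i} is missing too;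
    exchanging the last two parts of (m, 1, i) with m = n - 1 - i then forces the pair {m, m + 1}.
    This uses up \<open>f m = 1\<close>, so {m} is missing, and reflecting back gives {i + 1}.
    Iteration reaches {n - 1}, which has the multiplicity of {1}.\<close>
  have step: "a {Suc i} = 0" if z: "a {i} = 0" and i: "i \<in> {1..<n}" for i
  proof -
    have "i \<noteq> 1" "i \<noteq> n - 1" using z one a_last by auto
    then have i': "2 \<le> i" "i \<le> n - 2" using i by auto
    let ?m = "n - 1 - i"
    have "a {Suc ?m} + a {?m, Suc ?m} = a {n - 1} + a {?m, n - 1}"
      using swap3_last[of ?m "Suc ?m"] i' by simp
    moreover have "Suc ?m = n - i" using i' by simp
    then have "a {Suc ?m} = 0" using swap2[of i] i z by simp
    ultimately have "1 \<le> a {?m, Suc ?m}" using one a_last by simp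
    moreover have "f ?m = 1" by (rule eq1) (use i' in auto)
    moreover have "?m < n - 1" using i' by simp
    ultimately have "a {?m} = 0" unfolding f_def by simp
    then show ?thesis using swap2[of "Suc i"] i' by simp
  qed
  show ?thesis
  proof
    assume z: "a {i} = 0"
    have "i + k < n \<longrightarrow> a {i + k} = 0" for k
    proof (induction k)
      case (Suc k)
      then show ?case using step[of "i + k"] i by auto
    qed (use z in simp)
    from this[of "n - 1 - i"] show False using i one a_last by simp
  qed
qed

text \<open>Once {1} occurs, all n - 1 singletons do. In the induction the restricted family has at
  most n - 4 members for n - 2, one too few for this bound, so the absence of {1} comes for free
  there.\<close>

lemma card_ge_if_hook:
  assumes "2 \<le> n" "a {1} \<noteq> 0"
  shows "n - 1 \<le> card S"
proof (rule ccontr)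
  assume "\<not> ?thesis"
  then have "card S \<le> n - 1" "card S < n - 1" by auto
  have "inj_on (\<lambda>i :: nat. {i}) {1..<n}" by (simp add: inj_on_def)
  then have "(\<Sum>i\<in>{1..<n}. a {i}) \<le> card S" by (intro sum_a_le) auto
  moreover have "(\<Sum>i\<in>{1..<n}. 1) \<le> (\<Sum>i\<in>{1..<n}. a {i})"
    using all_singletons[OF assms(1) \<open>card S \<le> n - 1\<close> assms(2)] by (intro sum_mono) (simp add: Suc_leI)
  ultimately show False using \<open>card S < n - 1\<close> by simp
qed

lemma card_ge_if_cohook:
  assumes "2 \<le> n" "a ({1..<n} - {1}) \<noteq> 0"
  shows "n - 1 \<le> card S"
proof -
  interpret c: proper_symfam n S "\<lambda>w. {1..<n} - d w" by (rule complement)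
  show ?thesis using c.card_ge_if_hook assms dcount_complement[of "{1}"] by simp
qed

text \<open>If no descent set contains 1, the first part of a composition may be merged with a second part
  equal to 1, and swapping it back to the front merges all of them.\<close>

lemma empty_if_no_1:
  assumes n: "2 \<le> n" and no: "\<And>w. w \<in> S \<Longrightarrow> 1 \<notin> d w"
  shows "S = {}"
proof -
  \<comment> \<open>\<open>{k..n}\<close> is the set of partial sums of (k, 1, ..., 1). The count
    stays equal to the size of \<open>S\<close> up to k = n, where only the excluded empty descent
    set would be contained.\<close>
  have "card {w \<in> S. d w \<subseteq> {k..n}} = card S" if "1 \<le> k" "k \<le> n" for k
    using that
  proof (induction k rule: dec_induct)
    case base
    have "{w \<in> S. d w \<subseteq> {1..n}} = S" using d_subset by fastforce
    then show ?case by simp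
  next
    case (step k)
    have "rot 0 k (Suc k) ` {k..n} = insert 1 {Suc k..n}" (is "?L = ?R")
    proof
      show "?L \<subseteq> ?R" using step unfolding rot_def by auto
      have "1 = rot 0 k (Suc k) (Suc k)" "Suc k = rot 0 k (Suc k) k" using step unfolding rot_def by auto
      moreover have "j = rot 0 k (Suc k) j" if "Suc k < j" for j using that unfolding rot_def by auto
      moreover have "j = Suc k \<or> Suc k < j" if "j \<in> {Suc k..n}" for j using that by auto
      moreover have "Suc k \<in> {k..n}" "k \<in> {k..n}" using step by auto
      ultimately show "?R \<subseteq> ?L"
        by (smt (verit, ccfv_threshold) atLeastAtMost_iff imageI insert_iff le_SucI less_imp_le_nat nat_le_linear not_less_eq_eq subsetI)
    qed
    moreover have "card {w \<in> S. d w \<subseteq> rot 0 k (Suc k) ` {k..n}} = card {w \<in> S. d w \<subseteq> {k..n}}"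
      by (rule symfamD(3)[OF sf]) (use step n in auto)
    moreover have "{w \<in> S. d w \<subseteq> insert 1 {Suc k..n}} = {w \<in> S. d w \<subseteq> {Suc k..n}}" using no by blast
    ultimately show ?case using step by simp
  qed
  from this[of n] have "card {w \<in> S. d w \<subseteq> {n}} = card S" using n by simp
  moreover have "{w \<in> S. d w \<subseteq> {n}} = {}" using proper d_subset by fastforce
  ultimately show ?thesis using fin by (metis card.empty card_0_eq)
qed

text \<open>By the induction hypothesis the restriction has only trivial descent sets, so a descent
  set containing 1 is {1}, {1, 2}, all of \<open>{1..<n}\<close>, or all but 2. The first and third
  are excluded by assumption and the other two by swaps, after which \<open>empty_if_no_1\<close>
  applies.\<close>

lemma empty_if_few_1:
  assumes n: "7 \<le> n"
    and IH: "\<And>(S' :: 'a set) d'. \<lbrakk>proper_symfam (n - 2) S' d'; card S' \<le> n - 4\<rbrakk> \<Longrightarrow> S' = {}"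
    and hook: "a {1} = 0" "a ({1..<n} - {1}) = 0"
    and few: "card {w \<in> S. 1 \<in> d w} \<le> n - 4"
  shows "S = {}"
proof -
  define S1 where "S1 = {w \<in> S. 1 \<in> d w}"
  define d1 where "d1 = (\<lambda>w. (\<lambda>j. j - 2) ` (d w - {1, 2}))"
  have "symfam (n - 2) S1 d1" unfolding S1_def d1_def by (rule symfam_restrict[OF sf]) (use n in simp)
  then have sf': "symfam (n - 2) {w \<in> {w \<in> S1. d1 w \<noteq> {}}. d1 w \<noteq> {1..<n - 2}} d1"
    by (intro symfam_remove) auto
  have "{w \<in> {w \<in> S1. d1 w \<noteq> {}}. d1 w \<noteq> {1..<n - 2}} = {}"
  proof (rule IH)
    show "proper_symfam (n - 2) {w \<in> {w \<in> S1. d1 w \<noteq> {}}. d1 w \<noteq> {1..<n - 2}} d1"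
      by standard (use sf' in auto)
    have "card {w \<in> {w \<in> S1. d1 w \<noteq> {}}. d1 w \<noteq> {1..<n - 2}} \<le> card S1"
      using fin unfolding S1_def by (intro card_mono) auto
    then show "card {w \<in> {w \<in> S1. d1 w \<noteq> {}}. d1 w \<noteq> {1..<n - 2}} \<le> n - 4"
      using few unfolding S1_def by simp
  qed
  then have d1: "d1 w = {} \<or> d1 w = {1..<n - 2}" if "w \<in> S1" for w using that by blast
  have cases: "d w = {1, 2} \<or> d w = {1..<n} - {2}" if w: "w \<in> S" "1 \<in> d w" for w
  proof -
    have w1: "w \<in> S1" using w unfolding S1_def by simp
    have sub: "d w \<subseteq> {1..<n}" using d_subset w by blast
    have ne: "d w \<noteq> {1}" "d w \<noteq> {1..<n}" using a_0D[OF hook(1)] w proper by blast+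
    from d1[OF w1] show ?thesis
    proof
      assume "d1 w = {}"
      then have "d w \<subseteq> {1, 2}" unfolding d1_def by blast
      then show ?thesis using ne w by blast
    next
      assume e: "d1 w = {1..<n - 2}"
      have "j \<in> d w" if j: "3 \<le> j" "j < n" for j
      proof -
        have "j - 2 \<in> d1 w" using j unfolding e by auto
        then obtain i where "i \<in> d w" "i \<noteq> 1" "i \<noteq> 2" "j - 2 = i - 2" unfolding d1_def by blast
        moreover have "i \<noteq> 0" using sub \<open>i \<in> d w\<close> by fastforce
        ultimately have "i = j" using j by arith
        then show ?thesis using \<open>i \<in> d w\<close> by simp
      qed
      then have "{1..<n} - {2} \<subseteq> d w" using w(2)
        by (metis (no_types, lifting) DiffD1 DiffD2 One_nat_def Suc_1 Suc_leI atLeastLessThan_iff insertI1 le_neq_implies_less numeral_3_eq_3 subsetI)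
      then show ?thesis using sub ne(2) by blast
    qed
  qed
  \<comment> \<open>The other candidate \<open>{1..<n} - {2}\<close> is not a pair of this form,
    since it contains both 3 and 4.\<close>
  have pair0: "a {1, x} = 0" if x: "x \<noteq> 2" "x \<noteq> 1" for x
  proof (rule a_eq_0)
    fix w assume w: "w \<in> S"
    show "d w \<noteq> {1, x}"
    proof
      assume e: "d w = {1, x}"
      then have "{1, x} = {1, 2} \<or> {1, x} = {1..<n} - {2}" using cases[OF w] by auto
      moreover have "{1, x} \<noteq> {1, 2}" using x by (auto simp: doubleton_eq_iff)
      ultimately have "{1..<n} - {2} \<subseteq> {1, x}" by blast
      moreover have "3 \<in> {1..<n} - {2}" "4 \<in> {1..<n} - {2}" using n by auto
      ultimately have "3 \<in> {1, x}" "4 \<in> {1, x}" by blast+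
      then show False by simp
    qed
  qed
  have single0: "a {x} = 0" if "2 \<le> x" "x \<le> n - 2" for x
    using swap3_first[of 1 x] that n hook(1) pair0[of "Suc x"] by simp
  have "a {n - 1} = 0" using swap2[of 1] hook(1) n by simp
  then have "a {1, 2} = 0"
    using swap3_last[of 1 2] n hook(1) single0[of 2] pair0[of "n - 1"] by simp
  moreover have "a ({1..<n} - {2}) = 0"
  proof -
    interpret c: proper_symfam n S "\<lambda>w. {1..<n} - d w" by (rule complement)
    \<comment> \<open>Two-part symmetry of the complements trades the missing element 2 for n - 2.
      The resulting set contains 1, 2 and 3, which neither remaining candidate does.\<close>
    have "a ({1..<n} - {2}) = a ({1..<n} - {n - 2})"
      using c.swap2[of 2] dcount_complement[of "{2}"] dcount_complement[of "{n - 2}"] n by simp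
    also have "\<dots> = 0"
    proof (rule a_eq_0)
      fix w assume w: "w \<in> S"
      show "d w \<noteq> {1..<n} - {n - 2}"
      proof
        assume e: "d w = {1..<n} - {n - 2}"
        then have "1 \<in> d w" "2 \<in> d w" "3 \<in> d w" using n by auto
        then show False using cases[OF w] by auto
      qed
    qed
    finally show ?thesis .
  qed
  ultimately have "\<And>w. w \<in> S \<Longrightarrow> 1 \<notin> d w" using cases a_0D by blast
  then show ?thesis using n by (intro empty_if_no_1) auto
qed

section \<open>Multiplicity equations for n = 4, 5 and 6\<close>

lemma counts4:
  assumes n: "n = 4" and hook: "a {1} = 0" "a ({1..<n} - {1}) = 0"
  shows "card S = 2 * a {2}" "a {1, 3} = a {2}"
proof -
  interpret c: proper_symfam n S "\<lambda>w. {1..<n} - d w" by (rule complement)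
  have I: "{1..<n} = {1, 2, 3}" using n by auto
  have dc: "c.a {1} = a {2, 3}" "c.a {3} = a {1, 2}"
    using dcount_complement[of "{1}"] dcount_complement[of "{3}"] unfolding I by (simp_all add: insert_Diff_if)
  have "card S = between S d {} {1, 2, 3}" unfolding between_def
    using d_subset unfolding I by (intro arg_cong[where f = card]) auto
  also have "\<dots> = a {} + a {1} + a {2} + a {3} + a {1, 2} + a {1, 3} + a {2, 3} + a {1, 2, 3}"
    using fin by (simp add: between_insert between_empty insert_commute)
  finally have 1: "card S = a {} + a {1} + a {2} + a {3} + a {1, 2} + a {1, 3} + a {2, 3} + a {1, 2, 3}" .
  have 2: "a {} = 0" "a {1, 2, 3} = 0" using a_empty unfolding I by auto
  have 3: "a {3} = a {1}" using swap2[of 1] n by simp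
  have 4: "a {2, 3} = 0" using hook unfolding I by (simp add: insert_Diff_if)
  have 5: "a {1, 2} = 0" using c.swap2[of 1] n dc 4 by simp
  have 6: "a {2} + a {1, 2} = a {3} + a {1, 3}"
    using swap3_last[of 1 2] n by (simp add: insert_commute)
  \<comment> \<open>Only multiples of the shape (2, 2) survive; its standard tableaux have descent
    sets {2} and {1, 3}.\<close>
  show "card S = 2 * a {2}" "a {1, 3} = a {2}" using 1 2 3 4 5 6 hook(1) by auto
qed

text \<open>Solved form of the two- and three-part swaps in the absence of {1}: the parameters are
  \<open>a {2}\<close>, \<open>a {1, 2}\<close> and \<open>a {2, 3}\<close>. Larger descent sets are
  reached by applying the same equations to the complements.\<close>

lemma counts5_pairs:
  assumes n: "n = 5" and hook: "a {1} = 0"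
  shows "a {4} = 0" "a {3} = a {2}" "a {3, 4} = a {1, 2}" "a {1, 4} = a {1, 2} + a {2}"
    "a {1, 3} = a {2, 3} + a {2}" "a {2, 4} = a {2, 3} + a {2}"
proof -
  have "a {1} = a {4}" "a {2} = a {3}" using swap2[of 1] swap2[of 2] n by simp_all
  moreover have "a {1} + a {1, 3} = a {2} + a {2, 3}" using swap3_first[of 1 2] n by (simp add: numeral_3_eq_3)
  moreover have "a {1} + a {1, 4} = a {3} + a {3, 4}" using swap3_first[of 1 3] n by simp
  moreover have "a {2} + a {1, 2} = a {4} + a {1, 4}" "a {3} + a {2, 3} = a {4} + a {2, 4}"
    using swap3_last[of 1 2] swap3_last[of 2 3] n by simp_all
  ultimately show "a {4} = 0" "a {3} = a {2}" "a {3, 4} = a {1, 2}" "a {1, 4} = a {1, 2} + a {2}"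
    "a {1, 3} = a {2, 3} + a {2}" "a {2, 4} = a {2, 3} + a {2}"
    using hook by linarith+
qed

text \<open>As for n = 5, with the further parameter \<open>a {3}\<close>. The multiplicity of {2,
  4} stays free, because (2, 2, 2) is fixed by every exchange of parts.\<close>

lemma counts6_pairs:
  assumes n: "n = 6" and hook: "a {1} = 0"
  shows "a {5} = 0" "a {4} = a {2}" "a {4, 5} = a {1, 2}" "a {1, 5} = a {1, 2} + a {2}"
    "a {3, 4} = a {2, 3}" "a {1, 3} = a {2, 3} + a {2}" "a {3, 5} = a {2, 3} + a {2}"
    "a {1, 4} = a {2, 3} + a {3}" "a {2, 5} = a {2, 3} + a {3}"
proof -
  have "a {1} = a {5}" "a {2} = a {4}" using swap2[of 1] swap2[of 2] n by simp_all
  moreover have "a {1} + a {1, 3} = a {2} + a {2, 3}" using swap3_first[of 1 2] n by (simp add: numeral_3_eq_3)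
  moreover have "a {1} + a {1, 4} = a {3} + a {3, 4}" "a {1} + a {1, 5} = a {4} + a {4, 5}"
    "a {2} + a {2, 5} = a {3} + a {3, 5}"
    using swap3_first[of 1 3] swap3_first[of 1 4] swap3_first[of 2 3] n by simp_all
  moreover have "a {2} + a {1, 2} = a {5} + a {1, 5}" "a {3} + a {1, 3} = a {4} + a {1, 4}"
    "a {3} + a {2, 3} = a {5} + a {2, 5}"
    using swap3_last[of 1 2] swap3_last[of 1 3] swap3_last[of 2 3] n by simp_all
  ultimately show "a {5} = 0" "a {4} = a {2}" "a {4, 5} = a {1, 2}" "a {1, 5} = a {1, 2} + a {2}"
    "a {3, 4} = a {2, 3}" "a {1, 3} = a {2, 3} + a {2}" "a {3, 5} = a {2, 3} + a {2}"
    "a {1, 4} = a {2, 3} + a {3}" "a {2, 5} = a {2, 3} + a {3}"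
    using hook by linarith+
qed

lemma empty5:
  assumes n: "n = 5" and hook: "a {1} = 0" "a ({1..<n} - {1}) = 0" and card: "card S \<le> 4"
  shows "S = {}"
proof -
  interpret c: proper_symfam n S "\<lambda>w. {1..<n} - d w" by (rule complement)
  have I: "{1..<n} = {1, 2, 3, 4}" using n by auto
  have dc: "c.a {1} = a {2, 3, 4}" "c.a {2} = a {1, 3, 4}" "c.a {3} = a {1, 2, 4}" "c.a {4} = a {1, 2, 3}" "c.a {1, 2} = a {3, 4}" "c.a {1, 3} = a {2, 4}" "c.a {1, 4} = a {2, 3}" "c.a {2, 3} = a {1, 4}" "c.a {2, 4} = a {1, 3}" "c.a {3, 4} = a {1, 2}"
    using dcount_complement[of "{1}"]
      dcount_complement[of "{2}"]
      dcount_complement[of "{3}"]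
      dcount_complement[of "{4}"]
      dcount_complement[of "{1, 2}"]
      dcount_complement[of "{1, 3}"]
      dcount_complement[of "{1, 4}"]
      dcount_complement[of "{2, 3}"]
      dcount_complement[of "{2, 4}"]
      dcount_complement[of "{3, 4}"]
    unfolding I by (simp_all add: insert_Diff_if)
  have "card S = between S d {} {1, 2, 3, 4}" unfolding between_def
    using d_subset unfolding I by (intro arg_cong[where f = card]) auto
  also have "\<dots> = a {} + a {1} + a {2} + a {3} + a {4} + a {1, 2} + a {1, 3} + a {1, 4} + a {2, 3} + a {2, 4} + a {3, 4} + a {1, 2, 3} + a {1, 2, 4} + a {1, 3, 4} + a {2, 3, 4} + a {1, 2, 3, 4}"
    using fin by (simp add: between_insert between_empty insert_commute)
  finally have total: "card S = a {} + a {1} + a {2} + a {3} + a {4} + a {1, 2} + a {1, 3} + a {1, 4} + a {2, 3} + a {2, 4} + a {3, 4} + a {1, 2, 3} + a {1, 2, 4} + a {1, 3, 4} + a {2, 3, 4} + a {1, 2, 3, 4}" .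
  have "a {} = 0" "a {1, 2, 3, 4} = 0" using a_empty unfolding I by auto
  moreover have "c.a {1} = 0" using hook(2) dcount_complement[of "{1}"] n by simp
  note counts5_pairs[OF n hook(1)] c.counts5_pairs[OF n this, unfolded dc]
  moreover note \<open>c.a {1} = 0\<close>[unfolded dc]
  \<comment> \<open>The coefficients are the numbers of standard tableaux of shapes (3, 2), (2, 2,
    1) and (3, 1, 1); each exceeds the bound 4.\<close>
  ultimately have "card S = 5 * a {2} + 5 * a {1, 3, 4} + 6 * a {1, 2}" using total hook(1) by linarith
  then have "a {2} = 0" "a {1, 3, 4} = 0" "a {1, 2} = 0" "card S = 5 * a {2} + 5 * a {1, 3, 4} + 6 * a {1, 2}"
    using card by linarith+
  then have "card S = 0" by simp
  then show ?thesis using fin by simp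
qed

text \<open>Four-part version of the swap relations, without cancellation. The image of the cuts is
  a hypothesis, to be computed for concrete numbers.\<close>

lemma swap4:
  assumes "p < q" "q < r" "r \<le> n" "{x, y, z} \<subseteq> {1..<n}" "distinct [x, y, z]" "distinct [x', y', z']"
    "p \<in> {0, x, y, z, n}" "q \<in> {x, y, z, n}" "r \<in> {x, y, z, n}"
    "rot p q r ` {x, y, z, n} - {n} = {x', y', z'}"
  shows "a {x} + a {y} + a {z} + a {x, y} + a {x, z} + a {y, z} + a {x, y, z} =
    a {x'} + a {y'} + a {z'} + a {x', y'} + a {x', z'} + a {y', z'} + a {x', y', z'}"
proof -
  have "between S d {} (rot p q r ` {x, y, z, n} - {n}) = between S d {} ({x, y, z, n} - {n})"
    by (rule symfam_between[OF sf]) (use assms in auto)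
  moreover have "{x, y, z, n} - {n} = {x, y, z}" using assms by auto
  ultimately show ?thesis using assms(5,6) fin unfolding assms(10)
    by (simp add: between_insert between_empty insert_commute)
qed

lemma counts6:
  assumes n: "n = 6" and hook: "a {1} = 0" "a ({1..<n} - {1}) = 0" and card: "card S \<le> 5" and ne: "S \<noteq> {}"
  shows "card S = 5"
    "a {1, 3, 5} \<noteq> 0 \<and> a {2, 5} \<noteq> 0 \<and> a {3} \<noteq> 0 \<and> a {1, 4} \<noteq> 0 \<and> a {2, 4} \<noteq> 0 \<or>
     a {2, 4} \<noteq> 0 \<and> a {1, 3, 4} \<noteq> 0 \<and> a {1, 2, 4, 5} \<noteq> 0 \<and> a {2, 3, 5} \<noteq> 0 \<and> a {1, 3, 5} \<noteq> 0"
proof -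
  interpret c: proper_symfam n S "\<lambda>w. {1..<n} - d w" by (rule complement)
  have I: "{1..<n} = {1, 2, 3, 4, 5}" using n by auto
  have dc: "c.a {1} = a {2, 3, 4, 5}" "c.a {2} = a {1, 3, 4, 5}" "c.a {3} = a {1, 2, 4, 5}" "c.a {4} = a {1, 2, 3, 5}" "c.a {5} = a {1, 2, 3, 4}" "c.a {1, 2} = a {3, 4, 5}" "c.a {1, 3} = a {2, 4, 5}" "c.a {1, 4} = a {2, 3, 5}" "c.a {1, 5} = a {2, 3, 4}" "c.a {2, 3} = a {1, 4, 5}" "c.a {2, 4} = a {1, 3, 5}" "c.a {2, 5} = a {1, 3, 4}" "c.a {3, 4} = a {1, 2, 5}" "c.a {3, 5} = a {1, 2, 4}" "c.a {4, 5} = a {1, 2, 3}"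
    using dcount_complement[of "{1}"]
      dcount_complement[of "{2}"]
      dcount_complement[of "{3}"]
      dcount_complement[of "{4}"]
      dcount_complement[of "{5}"]
      dcount_complement[of "{1, 2}"]
      dcount_complement[of "{1, 3}"]
      dcount_complement[of "{1, 4}"]
      dcount_complement[of "{1, 5}"]
      dcount_complement[of "{2, 3}"]
      dcount_complement[of "{2, 4}"]
      dcount_complement[of "{2, 5}"]
      dcount_complement[of "{3, 4}"]
      dcount_complement[of "{3, 5}"]
      dcount_complement[of "{4, 5}"]
    unfolding I by (simp_all add: insert_Diff_if)
  have "card S = between S d {} {1, 2, 3, 4, 5}" unfolding between_def
    using d_subset unfolding I by (intro arg_cong[where f = card]) auto
  also have "\<dots> = a {} + a {1} + a {2} + a {3} + a {4} + a {5} + a {1, 2} + a {1, 3} + a {1, 4} + a {1, 5} + a {2, 3} + a {2, 4} + a {2, 5} + a {3, 4} + a {3, 5} + a {4, 5} + a {1, 2, 3} + a {1, 2, 4} + a {1, 2, 5} + a {1, 3, 4} + a {1, 3, 5} + a {1, 4, 5} + a {2, 3, 4} + a {2, 3, 5} + a {2, 4, 5} + a {3, 4, 5} + a {1, 2, 3, 4} + a {1, 2, 3, 5} + a {1, 2, 4, 5} + a {1, 3, 4, 5} + a {2, 3, 4, 5} + a {1, 2, 3, 4, 5}"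
    using fin by (simp add: between_insert between_empty insert_commute)
  finally have total: "card S = a {} + a {1} + a {2} + a {3} + a {4} + a {5} + a {1, 2} + a {1, 3} + a {1, 4} + a {1, 5} + a {2, 3} + a {2, 4} + a {2, 5} + a {3, 4} + a {3, 5} + a {4, 5} + a {1, 2, 3} + a {1, 2, 4} + a {1, 2, 5} + a {1, 3, 4} + a {1, 3, 5} + a {1, 4, 5} + a {2, 3, 4} + a {2, 3, 5} + a {2, 4, 5} + a {3, 4, 5} + a {1, 2, 3, 4} + a {1, 2, 3, 5} + a {1, 2, 4, 5} + a {1, 3, 4, 5} + a {2, 3, 4, 5} + a {1, 2, 3, 4, 5}" .
  have trivial: "a {} = 0" "a {1, 2, 3, 4, 5} = 0" using a_empty unfolding I by auto
  \<comment> \<open>The swaps used are (1, 1, 1, 3) to (1, 1, 3, 1), then (1, 1, 2, 2) to (1, 2, 1,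
    2), then (1, 2, 1, 2) to (1, 2, 2, 1).\<close>
  have q1: "a {1} + a {2} + a {3} + a {1, 2} + a {1, 3} + a {2, 3} + a {1, 2, 3} =
      a {1} + a {2} + a {5} + a {1, 2} + a {1, 5} + a {2, 5} + a {1, 2, 5}"
    by (rule swap4[of 2 3 6]) (use n in \<open>auto simp: rot_def\<close>)
  have q2: "a {1} + a {2} + a {4} + a {1, 2} + a {1, 4} + a {2, 4} + a {1, 2, 4} =
      a {1} + a {3} + a {4} + a {1, 3} + a {1, 4} + a {3, 4} + a {1, 3, 4}"
    by (rule swap4[of 1 2 4]) (use n in \<open>auto simp: rot_def\<close>)
  have q3: "a {1} + a {3} + a {4} + a {1, 3} + a {1, 4} + a {3, 4} + a {1, 3, 4} =
      a {1} + a {3} + a {5} + a {1, 3} + a {1, 5} + a {3, 5} + a {1, 3, 5}"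
    by (rule swap4[of 3 4 6]) (use n in \<open>auto simp: rot_def\<close>)
  have chook: "c.a {1} = 0" using hook(2) dcount_complement[of "{1}"] n by simp
  note eqs = hook(1) chook[unfolded dc] trivial counts6_pairs[OF n hook(1)] c.counts6_pairs[OF n chook, unfolded dc]
  \<comment> \<open>The unprimed letters parametrise the descent sets of size at most 2, the primed
    ones those of size at least 3, by way of complements.\<close>
  let ?s = "a {2}" and ?r = "a {3}" and ?u = "a {1, 2}" and ?v = "a {2, 3}" and ?w = "a {2, 4}"
  let ?s' = "c.a {2}" and ?r' = "c.a {3}" and ?u' = "c.a {1, 2}" and ?v' = "c.a {2, 3}" and ?w' = "c.a {2, 4}"
  have N: "card S = 5 * ?s + 3 * ?r + 3 * ?u + 6 * ?v + ?w + 5 * ?s' + 3 * ?r' + 3 * ?u' + 6 * ?v' + ?w'"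
    using total eqs unfolding dc by linarith
  have e1: "?v + ?u' = ?u + ?v'" using q1 eqs unfolding dc by linarith
  have e2: "?u + ?w + ?s' = ?r + 2 * ?v + ?r'" using q2 eqs unfolding dc by linarith
  have e3: "?w + ?v' + ?s' = ?s + ?v + ?w'" using q2 q3 eqs unfolding dc by linarith
  \<comment> \<open>Since \<open>card S \<le> 5\<close>, a positive \<open>?s\<close> would leave
    nothing else in the sum, against \<open>e3\<close>; likewise for \<open>?s'\<close>, while a
    single \<open>?v\<close> or \<open>?v'\<close> already costs 6. Then \<open>e1\<close> reads
    \<open>?u = ?u'\<close>, and the two together would again cost 6.\<close>
  have z: "?s = 0" "?s' = 0" "?v = 0" "?v' = 0" using N e1 e2 e3 card by linarith+
  then have z': "?u = 0" "?u' = 0" using N e1 card by linarith+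
  then have w: "?w = ?r + ?r'" "?w' = ?r + ?r'" using e2 e3 z by linarith+
  then have N': "card S = 5 * ?r + 5 * ?r'" using N z z' by simp
  moreover have "0 < card S" using ne fin by (simp add: card_gt_0_iff)
  ultimately have "?r + ?r' \<le> 1" "1 \<le> ?r + ?r'" using card by presburger+
  then have r: "?r + ?r' = 1" by simp
  then show "card S = 5" using N' by simp
  show "a {1, 3, 5} \<noteq> 0 \<and> a {2, 5} \<noteq> 0 \<and> a {3} \<noteq> 0 \<and> a {1, 4} \<noteq> 0 \<and> a {2, 4} \<noteq> 0 \<or>
     a {2, 4} \<noteq> 0 \<and> a {1, 3, 4} \<noteq> 0 \<and> a {1, 2, 4, 5} \<noteq> 0 \<and> a {2, 3, 5} \<noteq> 0 \<and> a {1, 3, 5} \<noteq> 0"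
    using r w eqs unfolding dc by linarith
qed

end

text \<open>Strong induction in steps of two from the bases 5 and 6. One of the parts 1 \<in> D and
  1 \<notin> D has at most n - 4 members, and passing to complements exchanges the two. The stricter
  bound at 6 keeps out the five-element families; coming from n = 8 it is met because n - 4 =
  4.\<close>

lemma empty_if_small:
  assumes "5 \<le> n" "proper_symfam n S d" "dcount S d {1} = 0" "dcount S d ({1..<n} - {1}) = 0"
    "card S \<le> n - 1" "n = 6 \<Longrightarrow> card S \<le> 4"
  shows "S = {}"
  using assms
proof (induction n arbitrary: S d rule: less_induct)
  case (less n)
  interpret proper_symfam n S d by fact
  show ?case
  proof (cases "n \<le> 6")
    case True
    then consider "n = 5" | "n = 6" using less.prems by linarith
    then show ?thesis
    proof cases
      case 1
      then show ?thesis using empty5 less.prems by simp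
    next
      case 2
      then show ?thesis using counts6(1) less.prems by fastforce
    qed
  next
    case False
    then have n: "7 \<le> n" by simp
    have IH: "S' = {}" if p: "proper_symfam (n - 2) S' d'" and c: "card S' \<le> n - 4" for S' and d' :: "'a \<Rightarrow> nat set"
    proof (rule less.IH)
      interpret p: proper_symfam "n - 2" S' d' by fact
      show "dcount S' d' {1} = 0" using p.card_ge_if_hook n c by force
      show "dcount S' d' ({1..<n - 2} - {1}) = 0" using p.card_ge_if_cohook n c by force
    qed (use p c n in auto)
    have part: "card S = card {w \<in> S. 1 \<in> d w} + card {w \<in> S. 1 \<notin> d w}"
      by (subst card_Un_disjoint[symmetric]) (use fin in \<open>auto intro: arg_cong[where f = card]\<close>)
    show ?thesis
    proof (cases "card {w \<in> S. 1 \<in> d w} \<le> n - 4")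
      case True
      show ?thesis
        by (rule empty_if_few_1[OF n]) (use IH less.prems True in auto)
    next
      case False
      then have few: "card {w \<in> S. 1 \<notin> d w} \<le> n - 4" using part less.prems n by linarith
      interpret c: proper_symfam n S "\<lambda>w. {1..<n} - d w" by (rule complement)
      have "{w \<in> S. 1 \<in> {1..<n} - d w} = {w \<in> S. 1 \<notin> d w}" using n by auto
      moreover have "c.a {1} = 0" using less.prems n dcount_complement[of "{1}"] by simp
      moreover have "{1..<n} - ({1..<n} - {1}) = {1}" using n by auto
      then have "c.a ({1..<n} - {1}) = 0" using less.prems dcount_complement[of "{1..<n} - {1}"] by simp
      ultimately show ?thesis
        by (intro c.empty_if_few_1[OF n]) (use IH few in auto)
    qed
  qed
qed

section \<open>Coefficients of fundamental quasisymmetric functions\<close>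

definition psum :: "(nat \<Rightarrow> nat) \<Rightarrow> nat \<Rightarrow> nat" where
  "psum \<alpha> k = (\<Sum>m\<le>k. \<alpha> m)"

text \<open>Only these exponent vectors can have a nonzero coefficient in degree n; index 0 stands
  for no variable.\<close>

definition exponents :: "nat \<Rightarrow> (nat \<Rightarrow> nat) \<Rightarrow> bool" where
  "exponents n \<alpha> \<longleftrightarrow> \<alpha> 0 = 0 \<and> finite {k. \<alpha> k \<noteq> 0} \<and> sum \<alpha> {k. \<alpha> k \<noteq> 0} = n"

definition words :: "nat \<Rightarrow> nat set \<Rightarrow> (nat \<Rightarrow> nat) \<Rightarrow> (nat \<Rightarrow> nat) set" where
  "words n D \<alpha> = {i. (\<forall>j \<in> {1..n}. 1 \<le> i j) \<and> (\<forall>j. j \<notin> {1..n} \<longrightarrow> i j = 0) \<and>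
      (\<forall>j \<in> {1..n-1}. i j \<le> i (Suc j)) \<and> (\<forall>j \<in> D. i j < i (Suc j)) \<and>
      (\<forall>k. card {j \<in> {1..n}. i j = k} = \<alpha> k)}"

lemma Fqs_words: "Fqs n D \<alpha> = int (card (words n D \<alpha>))"
  unfolding Fqs_def words_def ..

lemma mono_psum: "mono (psum \<alpha>)"
  unfolding psum_def by (intro monoI sum_mono2) auto

lemma psum_le:
  assumes "exponents n \<alpha>"
  shows "psum \<alpha> k \<le> n"
proof -
  have "psum \<alpha> k = sum \<alpha> ({..k} \<inter> {k. \<alpha> k \<noteq> 0})"
    unfolding psum_def by (rule sum.mono_neutral_right) auto
  also have "\<dots> \<le> sum \<alpha> {k. \<alpha> k \<noteq> 0}" using assms unfolding exponents_def by (intro sum_mono2) auto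
  finally show ?thesis using assms unfolding exponents_def by simp
qed

lemma psum_eventually:
  assumes "exponents n \<alpha>"
  shows "\<exists>M. \<forall>k\<ge>M. psum \<alpha> k = n"
proof -
  have "finite {k. \<alpha> k \<noteq> 0}" using assms unfolding exponents_def by blast
  then obtain M where M: "{k. \<alpha> k \<noteq> 0} \<subseteq> {..M}" unfolding finite_nat_set_iff_bounded_le by blast
  have "psum \<alpha> k = n" if "M \<le> k" for k
  proof -
    have "psum \<alpha> k = sum \<alpha> {k. \<alpha> k \<noteq> 0}"
      unfolding psum_def by (rule sum.mono_neutral_right) (use M that in auto)
    then show ?thesis using assms unfolding exponents_def by simp
  qed
  then show ?thesis by blast
qed

lemma downward_closed_eq_interval:
  assumes "B \<subseteq> {1..n}" "\<And>j. \<lbrakk>Suc j \<in> B; 1 \<le> j\<rbrakk> \<Longrightarrow> j \<in> B"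
  shows "B = {1..card B}"
proof (cases "B = {}")
  case False
  have fin: "finite B" using assms(1) finite_subset by blast
  have "j \<in> B" if "1 \<le> j" "j \<le> Max B" for j
  proof -
    have "1 \<le> Max B - k \<longrightarrow> Max B - k \<in> B" for k
    proof (induction k)
      case (Suc k)
      then show ?case using assms(2)[of "Max B - Suc k"] by (auto simp: Suc_diff_Suc)
    qed (use fin False in simp)
    from this[of "Max B - j"] that show ?thesis by simp
  qed
  then have "B = {1..Max B}" using assms(1) fin by (auto intro!: Max_ge)
  then show ?thesis by (metis card_atLeastAtMost diff_Suc_1)
qed simp

lemma words_exponents:
  assumes "i \<in> words n D \<alpha>"
  shows "exponents n \<alpha>"
proof -
  have c: "\<And>k. card {j \<in> {1..n}. i j = k} = \<alpha> k" and pos: "\<And>j. j \<in> {1..n} \<Longrightarrow> 1 \<le> i j"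
    using assms unfolding words_def by auto
  have supp: "{k. \<alpha> k \<noteq> 0} = i ` {1..n}"
  proof -
    have "\<alpha> k \<noteq> 0 \<longleftrightarrow> k \<in> i ` {1..n}" for k
      unfolding c[of k, symmetric] by (auto simp: card_eq_0_iff)
    then show ?thesis by blast
  qed
  have "0 \<notin> i ` {1..n}" using pos by fastforce
  then have "\<alpha> 0 = 0" using supp by blast
  moreover have "sum \<alpha> (i ` {1..n}) = n"
  proof -
    have "sum \<alpha> (i ` {1..n}) = (\<Sum>k\<in>i ` {1..n}. card {j \<in> {1..n}. i j = k})" using c by simp
    also have "\<dots> = (\<Sum>j\<in>{1..n}. 1)" using sum.image_gen[of "{1..n}" "\<lambda>_. 1 :: nat" i] by simp
    finally show ?thesis by simp
  qed
  ultimately show ?thesis unfolding exponents_def supp by simp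
qed

text \<open>In a weakly increasing word the letters up to k fill an initial segment, and the content
  fixes its length.\<close>

lemma words_le_iff:
  assumes i: "i \<in> words n D \<alpha>" and j: "j \<in> {1..n}"
  shows "i j \<le> k \<longleftrightarrow> j \<le> psum \<alpha> k"
proof -
  define B where "B = {j \<in> {1..n}. i j \<le> k}"
  have c: "\<And>k. card {j \<in> {1..n}. i j = k} = \<alpha> k" and mono: "\<And>j. j \<in> {1..n-1} \<Longrightarrow> i j \<le> i (Suc j)"
    using i unfolding words_def by auto
  have "card B = card (\<Union>m\<le>k. {j \<in> {1..n}. i j = m})"
    unfolding B_def by (rule arg_cong[where f = card]) auto
  also have "\<dots> = psum \<alpha> k"
    unfolding psum_def by (subst card_UN_disjoint) (auto simp: c[simplified])
  finally have "card B = psum \<alpha> k" .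
  moreover have "B = {1..card B}"
  proof (rule downward_closed_eq_interval[where n = n])
    fix j assume "Suc j \<in> B" "1 \<le> j"
    then have "j \<in> {1..n-1}" unfolding B_def by auto
    then show "j \<in> B" using mono[of j] \<open>Suc j \<in> B\<close> unfolding B_def by auto
  qed (auto simp: B_def)
  ultimately have "j \<in> B \<longleftrightarrow> j \<le> psum \<alpha> k" using j by (metis atLeastAtMost_iff)
  then show ?thesis using j unfolding B_def by simp
qed

text \<open>Inverse of the step function \<open>psum \<alpha>\<close>: position j carries the first
  variable at which the partial sum reaches j. The value 0 outside \<open>{1..n}\<close> follows the
  convention of \<open>words\<close>.\<close>

definition sorted_word :: "nat \<Rightarrow> (nat \<Rightarrow> nat) \<Rightarrow> nat \<Rightarrow> nat" where
  "sorted_word n \<alpha> j = (if j \<in> {1..n} then LEAST k. j \<le> psum \<alpha> k else 0)"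

lemma sorted_word_le_iff:
  assumes e: "exponents n \<alpha>" and j: "j \<in> {1..n}"
  shows "sorted_word n \<alpha> j \<le> k \<longleftrightarrow> j \<le> psum \<alpha> k"
proof -
  have ex: "\<exists>k. j \<le> psum \<alpha> k" using psum_eventually[OF e] j by (metis atLeastAtMost_iff order_refl)
  have sw: "sorted_word n \<alpha> j = (LEAST k. j \<le> psum \<alpha> k)" using j unfolding sorted_word_def by simp
  show ?thesis
  proof
    assume "sorted_word n \<alpha> j \<le> k"
    moreover have "j \<le> psum \<alpha> (sorted_word n \<alpha> j)" unfolding sw using ex by (rule LeastI_ex)
    ultimately show "j \<le> psum \<alpha> k" using monoD[OF mono_psum] le_trans by blast
  qed (simp add: sw Least_le)
qed

lemma words_unique:
  assumes "i \<in> words n D \<alpha>"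
  shows "i = sorted_word n \<alpha>"
proof
  fix j
  show "i j = sorted_word n \<alpha> j"
  proof (cases "j \<in> {1..n}")
    case True
    then have "i j \<le> k \<longleftrightarrow> sorted_word n \<alpha> j \<le> k" for k
      using words_le_iff[OF assms] sorted_word_le_iff[OF words_exponents[OF assms]] by simp
    then show ?thesis by (metis le_antisym order_refl)
  qed (use assms in \<open>auto simp: words_def sorted_word_def\<close>)
qed

text \<open>A new letter starts exactly where the previous one is used up, that is, after a partial
  sum of the exponents.\<close>

lemma sorted_word_ascent_iff:
  assumes e: "exponents n \<alpha>" and j: "j \<in> {1..<n}"
  shows "sorted_word n \<alpha> j < sorted_word n \<alpha> (Suc j) \<longleftrightarrow> j \<in> range (psum \<alpha>)"
proof -
  have j': "j \<in> {1..n}" "Suc j \<in> {1..n}" using j by auto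
  note iff = sorted_word_le_iff[OF e j'(1)] sorted_word_le_iff[OF e j'(2)]
  show ?thesis
  proof
    assume "sorted_word n \<alpha> j < sorted_word n \<alpha> (Suc j)"
    then have "j \<le> psum \<alpha> (sorted_word n \<alpha> j)" "\<not> Suc j \<le> psum \<alpha> (sorted_word n \<alpha> j)"
      using iff by (metis order_refl, metis leD)
    then show "j \<in> range (psum \<alpha>)" by (metis not_less_eq_eq le_antisym rangeI)
  next
    assume "j \<in> range (psum \<alpha>)"
    then obtain k where "j = psum \<alpha> k" by blast
    then have "sorted_word n \<alpha> j \<le> k" "\<not> sorted_word n \<alpha> (Suc j) \<le> k" using iff by auto
    then show "sorted_word n \<alpha> j < sorted_word n \<alpha> (Suc j)" by simp
  qed
qed

lemma sorted_word_in_words: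
  assumes e: "exponents n \<alpha>" and D: "D \<subseteq> {1..<n}" "D \<subseteq> range (psum \<alpha>)"
  shows "sorted_word n \<alpha> \<in> words n D \<alpha>"
  unfolding words_def
proof (intro CollectI conjI ballI allI impI)
  note iff = sorted_word_le_iff[OF e]
  have p0: "psum \<alpha> 0 = 0" using e unfolding psum_def exponents_def by simp
  fix j
  show "1 \<le> sorted_word n \<alpha> j" if j: "j \<in> {1..n}"
    using iff[OF j, of 0] p0 j by (simp add: Suc_leI)
  show "sorted_word n \<alpha> j \<le> sorted_word n \<alpha> (Suc j)" if "j \<in> {1..n-1}"
  proof -
    have "j \<in> {1..n}" "Suc j \<in> {1..n}" using that by auto
    then show ?thesis using iff by (metis Suc_leD order_refl)
  qed
  show "sorted_word n \<alpha> j < sorted_word n \<alpha> (Suc j)" if "j \<in> D"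
    using that D sorted_word_ascent_iff[OF e] by blast
  show "sorted_word n \<alpha> j = 0" if "j \<notin> {1..n}" using that unfolding sorted_word_def by auto
  fix k
  have le: "{j \<in> {1..n}. sorted_word n \<alpha> j \<le> m} = {1..psum \<alpha> m}" for m
    using iff psum_le[OF e, of m] by auto
  show "card {j \<in> {1..n}. sorted_word n \<alpha> j = k} = \<alpha> k"
  proof (cases k)
    case 0
    then have "{j \<in> {1..n}. sorted_word n \<alpha> j = k} = {}" using le[of 0] p0 by auto
    then show ?thesis using e 0 unfolding exponents_def by simp
  next
    case (Suc m)
    have "{j \<in> {1..n}. sorted_word n \<alpha> j = k} = {1..psum \<alpha> k} - {1..psum \<alpha> m}"
      unfolding le[symmetric] using Suc by auto
    moreover have "psum \<alpha> k = psum \<alpha> m + \<alpha> k" unfolding psum_def Suc by simp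
    ultimately show ?thesis by (simp add: card_Diff_subset)
  qed
qed

text \<open>The exponents determine the sorted word, so only its strictness at \<open>D\<close> is
  left to test. Every coefficient thereby becomes a condition on partial sums.\<close>

lemma Fqs_eq:
  assumes "D \<subseteq> {1..<n}"
  shows "Fqs n D \<alpha> = (if exponents n \<alpha> \<and> D \<subseteq> range (psum \<alpha>) then 1 else 0)"
proof (cases "exponents n \<alpha> \<and> D \<subseteq> range (psum \<alpha>)")
  case True
  then have "words n D \<alpha> = {sorted_word n \<alpha>}"
    using words_unique sorted_word_in_words assms by blast
  then show ?thesis using True unfolding Fqs_words by simp
next
  case False
  have "i \<notin> words n D \<alpha>" for i
  proof
    assume i: "i \<in> words n D \<alpha>"
    then have "\<And>j. j \<in> D \<Longrightarrow> sorted_word n \<alpha> j < sorted_word n \<alpha> (Suc j)"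
      using words_unique[OF i] unfolding words_def by auto
    then have "D \<subseteq> range (psum \<alpha>)" using sorted_word_ascent_iff words_exponents[OF i] assms by blast
    then show False using False words_exponents[OF i] by blast
  qed
  then have "words n D \<alpha> = {}" by blast
  then show ?thesis using False unfolding Fqs_words by simp
qed

lemma finite_words: "finite (words n D \<alpha>)"
  by (rule finite_subset[of _ "{sorted_word n \<alpha>}"]) (use words_unique in auto)

lemma exponents_permute:
  assumes "\<sigma> permutes {1..}" "exponents n \<alpha>"
  shows "exponents n (\<alpha> \<circ> \<sigma>)"
proof -
  have 0: "\<sigma> 0 = 0" using assms(1) by (simp add: permutes_def)
  have bij: "bij \<sigma>" using assms(1) by (rule permutes_bij)
  have img: "\<sigma> ` {k. (\<alpha> \<circ> \<sigma>) k \<noteq> 0} = {k. \<alpha> k \<noteq> 0}"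
  proof
    show "{k. \<alpha> k \<noteq> 0} \<subseteq> \<sigma> ` {k. (\<alpha> \<circ> \<sigma>) k \<noteq> 0}"
    proof
      fix k assume "k \<in> {k. \<alpha> k \<noteq> 0}"
      moreover obtain m where "k = \<sigma> m" using bij by (metis bij_pointE)
      ultimately show "k \<in> \<sigma> ` {k. (\<alpha> \<circ> \<sigma>) k \<noteq> 0}" by auto
    qed
  qed auto
  have inj: "inj_on \<sigma> A" for A using bij by (meson bij_is_inj inj_on_subset subset_UNIV)
  have "finite {k. (\<alpha> \<circ> \<sigma>) k \<noteq> 0}" using img assms(2) inj finite_imageD unfolding exponents_def by metis
  moreover have "sum (\<alpha> \<circ> \<sigma>) {k. (\<alpha> \<circ> \<sigma>) k \<noteq> 0} = n"
    using sum.reindex[OF inj, of \<alpha> "{k. (\<alpha> \<circ> \<sigma>) k \<noteq> 0}"] img assms(2) unfolding exponents_def by metis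
  ultimately show ?thesis using assms(2) 0 unfolding exponents_def by simp
qed

text \<open>The composition with partial sums \<open>V\<close> is realised by putting the exponent of the variable with
  index \<open>j \<in> V\<close> equal to the gap below \<open>j\<close>; a block swap is then a permutation of the variables.\<close>

definition gap :: "nat set \<Rightarrow> nat \<Rightarrow> nat" where
  "gap V j = (if j \<in> V then j - Max (insert 0 {v \<in> V. v < j}) else 0)"

text \<open>The gaps telescope, with 0 serving as the element before the first.\<close>

lemma psum_gap:
  assumes "0 \<notin> V"
  shows "psum (gap V) k = Max (insert 0 {v \<in> V. v \<le> k})"
proof (induction k)
  case 0
  have "Max (insert 0 {v \<in> V. v \<le> 0}) = 0" by (rule Max_eqI) auto
  then show ?case using assms unfolding psum_def gap_def by simp
next
  case (Suc k)
  have fin: "finite {v \<in> V. v \<le> m}" for m by simp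
  have lt: "{v \<in> V. v < Suc k} = {v \<in> V. v \<le> k}" by auto
  have step: "psum (gap V) (Suc k) = psum (gap V) k + gap V (Suc k)" unfolding psum_def by simp
  show ?case
  proof (cases "Suc k \<in> V")
    case True
    have "Max (insert 0 {v \<in> V. v \<le> k}) \<le> Suc k" using fin by (subst Max_le_iff) auto
    moreover have "Max (insert 0 {v \<in> V. v \<le> Suc k}) = Suc k"
      by (rule Max_eqI) (use True fin in auto)
    moreover have "gap V (Suc k) = Suc k - Max (insert 0 {v \<in> V. v \<le> k})"
      using True unfolding gap_def lt by simp
    ultimately show ?thesis unfolding step Suc.IH by simp
  next
    case False
    then have "{v \<in> V. v \<le> Suc k} = {v \<in> V. v \<le> k}" by (auto simp: le_Suc_eq)
    moreover have "gap V (Suc k) = 0" using False unfolding gap_def by simp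
    ultimately show ?thesis unfolding step Suc.IH by simp
  qed
qed

lemma range_psum_gap:
  assumes "V \<subseteq> {1..n}"
  shows "range (psum (gap V)) = insert 0 V"
proof -
  have 0: "0 \<notin> V" using assms by auto
  have "psum (gap V) k \<in> insert 0 V" for k
    unfolding psum_gap[OF 0] using Max_in[of "insert 0 {v \<in> V. v \<le> k}"] by auto
  moreover have "psum (gap V) k = k" if "k \<in> insert 0 V" for k
    unfolding psum_gap[OF 0] by (rule Max_eqI) (use that in auto)
  ultimately show ?thesis by (metis equalityI image_subsetI rangeI subsetI)
qed

lemma exponents_gap:
  assumes "V \<subseteq> {1..n}" "n \<in> V"
  shows "exponents n (gap V)"
proof -
  have 0: "0 \<notin> V" using assms by auto
  have supp: "{k. gap V k \<noteq> 0} \<subseteq> {..n}" using assms(1) unfolding gap_def by (auto split: if_splits)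
  have "sum (gap V) {k. gap V k \<noteq> 0} = psum (gap V) n"
    unfolding psum_def by (rule sum.mono_neutral_left) (use supp in auto)
  also have "\<dots> = n" unfolding psum_gap[OF 0] by (rule Max_eqI) (use assms in auto)
  finally show ?thesis using 0 finite_subset[OF supp] unfolding exponents_def gap_def by simp
qed

lemma gap_eq_diff:
  assumes "j \<in> V" "p < j" "p \<in> insert 0 V" "\<And>v. \<lbrakk>v \<in> V; v < j\<rbrakk> \<Longrightarrow> v \<le> p"
  shows "gap V j = j - p"
proof -
  have "Max (insert 0 {v \<in> V. v < j}) = p"
    by (rule Max_eqI) (use assms in auto)
  then show ?thesis using assms(1) unfolding gap_def by simp
qed

text \<open>Both blocks are translated rigidly, so distances inside a block are kept. Only the first
  element after p, q or r changes its predecessor: the new one is the image of r, the point p, or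
  the image of q respectively, at the old distance.\<close>

lemma gap_rot:
  assumes "p < q" "q < r" and V: "0 \<notin> V" "p \<in> insert 0 V" "q \<in> V" "r \<in> V"
  shows "gap (rot p q r ` V) (rot p q r j) = gap V j"
proof (cases "j \<in> V")
  case False
  then have "rot p q r j \<notin> rot p q r ` V" using inj_rot[of p q r] assms by (simp add: inj_image_mem_iff)
  then show ?thesis using False unfolding gap_def by simp
next
  case True
  define P where "P = Max (insert 0 {v \<in> V. v < j})"
  have "P \<in> insert 0 {v \<in> V. v < j}" unfolding P_def by (rule Max_in) auto
  moreover have "0 < j" using True V by (cases j) auto
  ultimately have P: "P \<in> insert 0 V" "P < j" by auto
  have below: "v \<le> P" if "v \<in> insert 0 V" "v < j" for v unfolding P_def by (rule Max_ge) (use that in auto)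
  have g: "gap V j = j - P" by (rule gap_eq_diff) (use True P below in auto)
  have img: "rot p q r j \<in> rot p q r ` V" using True by blast
  have mem: "x \<in> insert 0 (rot p q r ` V)" if "u \<in> V" "x = rot p q r u" for x u using that by blast
  consider "j \<le> p" | "p < j" "j \<le> q" | "q < j" "j \<le> r" | "r < j" by linarith
  then show ?thesis
  proof cases
    case 1
    have "gap (rot p q r ` V) (rot p q r j) = rot p q r j - P"
    proof (rule gap_eq_diff[OF img])
      show "P \<in> insert 0 (rot p q r ` V)"
      proof (cases "P = 0")
        case False
        then show ?thesis using P 1 by (intro mem[of P]) (auto simp: rot_def)
      qed simp
      show "P < rot p q r j" using 1 P(2) unfolding rot_def by simp
      fix v assume "v \<in> rot p q r ` V" "v < rot p q r j"
      then obtain u where u: "u \<in> V" "v = rot p q r u" by blast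
      then have "u < j" using \<open>v < rot p q r j\<close> 1 assms(1,2) by (auto simp: rot_def split: if_splits)
      then show "v \<le> P" using 1 below[of u] u by (simp add: rot_def)
    qed
    then show ?thesis using 1 g unfolding rot_def by auto
  next
    case 2
    have p: "p \<le> P" using below[of p] V 2 by auto
    have "gap (rot p q r ` V) (rot p q r j) = rot p q r j - (P + (r - q))"
    proof (rule gap_eq_diff[OF img])
      show "P + (r - q) \<in> insert 0 (rot p q r ` V)"
      proof (cases "P = p")
        case True
        then show ?thesis using assms by (intro mem[of r]) (auto simp: rot_def)
      next
        case False
        then show ?thesis using P p 2 assms by (intro mem[of P]) (auto simp: rot_def)
      qed
      fix v assume "v \<in> rot p q r ` V" "v < rot p q r j"
      then obtain u where u: "u \<in> V" "v = rot p q r u" by blast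
      then have "u < j \<or> q < u \<and> u \<le> r" using \<open>v < rot p q r j\<close> 2 assms(1,2) by (auto simp: rot_def split: if_splits)
      then show "v \<le> P + (r - q)" using p 2 below[of u] assms(1,2) u by (auto simp: rot_def split: if_splits)
    next
      show "P + (r - q) < rot p q r j" using 2 P(2) unfolding rot_def by simp
    qed
    then show ?thesis using 2 g unfolding rot_def by auto
  next
    case 3
    have q: "q \<le> P" using below[of q] V 3 by auto
    have "gap (rot p q r ` V) (rot p q r j) = rot p q r j - (P - (q - p))"
    proof (rule gap_eq_diff[OF img])
      show "P - (q - p) \<in> insert 0 (rot p q r ` V)"
      proof (cases "P = q")
        case True
        moreover have "p \<in> insert 0 (rot p q r ` V)"
        proof (cases "p = 0")
          case False
          then show ?thesis using V by (intro mem[of p]) (auto simp: rot_def)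
        qed simp
        ultimately show ?thesis using assms by simp
      next
        case False
        then show ?thesis using P q 3 assms by (intro mem[of P]) (auto simp: rot_def)
      qed
      fix v assume "v \<in> rot p q r ` V" "v < rot p q r j"
      then obtain u where u: "u \<in> V" "v = rot p q r u" by blast
      have "u \<le> p \<or> q < u \<and> u < j" using u(2) \<open>v < rot p q r j\<close> 3 assms(1,2) by (auto simp: rot_def split: if_splits)
      then show "v \<le> P - (q - p)" using q 3 below[of u] assms(1,2) u by (auto simp: rot_def split: if_splits)
    next
      show "P - (q - p) < rot p q r j" using 3 P(2) q assms(1,2) unfolding rot_def by (simp; linarith)
    qed
    then show ?thesis using 3 g q assms unfolding rot_def by auto
  next
    case 4
    have r: "r \<le> P" using below[of r] V 4 by auto
    have "gap (rot p q r ` V) (rot p q r j) = rot p q r j - P"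
    proof (rule gap_eq_diff[OF img])
      show "P \<in> insert 0 (rot p q r ` V)"
      proof (cases "P = r")
        case True
        then show ?thesis using assms by (intro mem[of q]) (auto simp: rot_def)
      next
        case False
        then show ?thesis using P r assms by (intro mem[of P]) (auto simp: rot_def)
      qed
      fix v assume "v \<in> rot p q r ` V" "v < rot p q r j"
      then obtain u where u: "u \<in> V" "v = rot p q r u" by blast
      have "u \<le> r \<or> r < u \<and> u < j" using u(2) \<open>v < rot p q r j\<close> 4 assms(1,2) by (auto simp: rot_def split: if_splits)
      then show "v \<le> P" using r 4 below[of u] assms(1,2) u by (auto simp: rot_def split: if_splits)
    next
      show "P < rot p q r j" using 4 P(2) assms(1,2) unfolding rot_def by simp
    qed
    then show ?thesis using 4 g assms unfolding rot_def by auto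
  qed
qed

lemma rot_permutes:
  assumes "p < q" "q < r"
  shows "rot p q r permutes {1..}"
proof -
  have le: "p \<le> q" "q \<le> r" using assms by auto
  have "rot p q r (rot p (p + r - q) r j) = j" for j
    using rot_inverse[of p "p + r - q" r j] assms by simp
  then have "bij (rot p q r)" using inj_rot[OF le] by (metis bijI surj_def)
  moreover have "rot p q r j = j" if "j \<notin> {1..}" for j using that unfolding rot_def by auto
  ultimately show ?thesis by (simp add: permutes_def bij_iff)
qed

text \<open>Both Q(S), indexed by permutations, and a Schur function, indexed by standard tableaux,
  take this form.\<close>

definition family_qf :: "nat \<Rightarrow> 'a set \<Rightarrow> ('a \<Rightarrow> nat set) \<Rightarrow> qf" where
  "family_qf n S d \<alpha> = (\<Sum>w\<in>S. Fqs n (d w) \<alpha>)"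

lemma family_qf_eq:
  assumes "finite S" "\<And>w. w \<in> S \<Longrightarrow> d w \<subseteq> {1..<n}"
  shows "family_qf n S d \<alpha> = (if exponents n \<alpha> then int (card {w \<in> S. d w \<subseteq> range (psum \<alpha>)}) else 0)"
  using assms unfolding family_qf_def by (simp add: Fqs_eq card_as_sum)

text \<open>The coefficient at the exponent vector \<open>gap V\<close> is the count for
  \<open>V\<close>, and by \<open>gap_rot\<close> a swap only permutes the variables of that
  monomial.\<close>

lemma symfam_if_symmetric:
  assumes fin: "finite S" and d: "\<And>w. w \<in> S \<Longrightarrow> d w \<subseteq> {1..<n}" and sym: "symmetric_fn (family_qf n S d)"
  shows "symfam n S d"
  unfolding symfam_def
proof (intro conjI allI impI ballI)
  fix p q r V
  assume A: "p < q" "q < r" "r \<le> n" "V \<subseteq> {1..n}" "n \<in> V" "p \<in> insert 0 V" "q \<in> V" "r \<in> V"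
  let ?\<rho> = "rot p q r"
  have le: "p \<le> q" "q \<le> r" using A by auto
  have V': "?\<rho> ` V \<subseteq> {1..n}" using rot_image_interval[OF le A(3)] A(4) by blast
  have n': "n \<in> ?\<rho> ` V" by (rule rot_mem_top) (use A in auto)
  have key: "family_qf n S d (gap U) = int (card {w \<in> S. d w \<subseteq> U})" if "U \<subseteq> {1..n}" "n \<in> U" for U
  proof -
    have "{w \<in> S. d w \<subseteq> insert 0 U} = {w \<in> S. d w \<subseteq> U}" using d by fastforce
    then show ?thesis using exponents_gap[OF that] by (simp add: family_qf_eq[OF fin d] range_psum_gap[OF that(1)])
  qed
  have "gap (?\<rho> ` V) \<circ> ?\<rho> = gap V"
  proof
    fix j
    have "0 \<notin> V" using A by auto
    then show "(gap (?\<rho> ` V) \<circ> ?\<rho>) j = gap V j" unfolding comp_def by (rule gap_rot[OF A(1,2)]) (use A in auto)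
  qed
  then have "family_qf n S d (gap V) = family_qf n S d (gap (?\<rho> ` V))"
    using sym rot_permutes[OF A(1,2)] unfolding symmetric_fn_def by metis
  then show "card {w \<in> S. d w \<subseteq> ?\<rho> ` V} = card {w \<in> S. d w \<subseteq> V}"
    using key[OF A(4,5)] key[OF V' n'] by simp
qed (use fin d in auto)

section \<open>Symmetry of the exceptional families\<close>

fun sums :: "nat \<Rightarrow> nat list \<Rightarrow> nat set" where
  "sums s [] = {s}"
| "sums s (x # xs) = insert s (sums (s + x) xs)"

lemma start_in_sums: "s \<in> sums s xs"
  by (cases xs) auto

lemma sums_filter: "sums s (filter (\<lambda>x. x \<noteq> 0) xs) = sums s xs"
  by (induction xs arbitrary: s) (auto simp: insert_absorb start_in_sums)

lemma sums_eq: "sums s xs = (\<lambda>k. s + sum_list (take k xs)) ` {..length xs}"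
proof (induction xs arbitrary: s)
  case (Cons x xs)
  have "{..length (x # xs)} = insert 0 (Suc ` {..length xs})"
    by (simp add: atMost_Suc_eq_insert_0)
  then show ?case using Cons[of "s + x"] by (simp add: image_image add.assoc)
qed simp

lemma sums_bounds: "sums s xs \<subseteq> {s..s + sum_list xs}" "s + sum_list xs \<in> sums s xs"
proof -
  show "sums s xs \<subseteq> {s..s + sum_list xs}" by (induction xs arbitrary: s) fastforce+
  show "s + sum_list xs \<in> sums s xs" by (induction xs arbitrary: s) (auto simp: add.assoc[symmetric])
qed

lemma card_sums:
  assumes "0 \<notin> set xs"
  shows "card (sums s xs) = Suc (length xs)"
  using assms
proof (induction xs arbitrary: s)
  case (Cons x xs)
  have "s \<notin> sums (s + x) xs" using sums_bounds(1)[of "s + x" xs] Cons.prems by fastforce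
  moreover have "finite (sums (s + x) xs)" using sums_bounds(1) finite_subset by blast
  ultimately show ?case using Cons by simp
qed simp

lemma range_psum_sums:
  assumes e: "exponents n \<alpha>" and M: "{k. \<alpha> k \<noteq> 0} \<subseteq> {..<M}"
  shows "range (psum \<alpha>) = sums 0 (map \<alpha> [0..<M])"
proof -
  have take: "sum_list (take k (map \<alpha> [0..<M])) = (\<Sum>m<min k M. \<alpha> m)" for k
  proof -
    have "take k [0..<M] = [0..<min k M]" by (cases "k \<le> M") auto
    then show ?thesis by (simp add: take_map interv_sum_list_conv_sum_set_nat lessThan_atLeast0)
  qed
  have psum: "psum \<alpha> k = (\<Sum>m<min (Suc k) M. \<alpha> m)" for k
    unfolding psum_def by (rule sum.mono_neutral_right) (use M in auto)
  have p0: "psum \<alpha> 0 = 0" using e unfolding psum_def exponents_def by simp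
  show ?thesis unfolding sums_eq
  proof (intro set_eqI iffI)
    fix x assume "x \<in> range (psum \<alpha>)"
    then obtain k where "x = psum \<alpha> k" by blast
    then have "x = 0 + sum_list (take (min (Suc k) M) (map \<alpha> [0..<M]))" unfolding take psum by simp
    then show "x \<in> (\<lambda>k. 0 + sum_list (take k (map \<alpha> [0..<M]))) ` {..length (map \<alpha> [0..<M])}" by fastforce
  next
    fix x assume "x \<in> (\<lambda>k. 0 + sum_list (take k (map \<alpha> [0..<M]))) ` {..length (map \<alpha> [0..<M])}"
    then obtain k where k: "k \<le> M" "x = (\<Sum>m<k. \<alpha> m)" unfolding take by (auto simp: min_def)
    show "x \<in> range (psum \<alpha>)"
    proof (cases k)
      case 0
      then show ?thesis using k p0 by (metis lessThan_0 rangeI sum.empty)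
    next
      case (Suc l)
      then have "x = psum \<alpha> l" using k(2) unfolding psum_def by (simp only: lessThan_Suc_atMost)
      then show ?thesis by blast
    qed
  qed
qed

text \<open>Reduces symmetry in infinitely many variables to rearrangements of compositions of \<open>n\<close>.\<close>

lemma symmetric_if_rearrangement_invariant:
  assumes fin: "finite S" and d: "\<And>w. w \<in> S \<Longrightarrow> d w \<subseteq> {1..<n}"
    and inv: "\<And>xs ys. \<lbrakk>0 \<notin> set xs; sum_list xs = n; mset xs = mset ys\<rbrakk> \<Longrightarrow>
      card {w \<in> S. d w \<subseteq> sums 0 xs} = card {w \<in> S. d w \<subseteq> sums 0 ys}"
  shows "symmetric_fn (family_qf n S d)"
  unfolding symmetric_fn_def
proof (intro allI impI)
  fix \<sigma> \<alpha> assume \<sigma>: "\<sigma> permutes {1 :: nat..}"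
  note eq = family_qf_eq[where d = d, OF fin d]
  \<comment> \<open>Listing these exponents in the order of the variables gives a composition, and
    permuting the variables merely rearranges it.\<close>
  define parts where "parts = (\<lambda>\<beta> :: nat \<Rightarrow> nat. image_mset \<beta> (mset_set {k. \<beta> k \<noteq> 0}))"
  have ex: "\<exists>xs. range (psum \<beta>) = sums 0 xs \<and> 0 \<notin> set xs \<and> mset xs = parts \<beta>" if e: "exponents n \<beta>" for \<beta>
  proof -
    have "finite {k. \<beta> k \<noteq> 0}" using e unfolding exponents_def by blast
    then obtain M where M: "{k. \<beta> k \<noteq> 0} \<subseteq> {..<M}" unfolding finite_nat_set_iff_bounded by blast
    let ?xs = "filter (\<lambda>x. x \<noteq> 0) (map \<beta> [0..<M])"
    have "range (psum \<beta>) = sums 0 ?xs" using range_psum_sums[OF e M] sums_filter by simp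
    moreover have "mset ?xs = parts \<beta>"
    proof -
      have "{k \<in> {0..<M}. \<beta> k \<noteq> 0} = {k. \<beta> k \<noteq> 0}" using M by auto
      moreover have "mset ?xs = image_mset \<beta> (mset_set {k \<in> {0..<M}. \<beta> k \<noteq> 0})"
        by (simp add: filter_map comp_def filter_mset_mset_set)
      ultimately show ?thesis unfolding parts_def by simp
    qed
    moreover have "0 \<notin> set ?xs" by simp
    ultimately show ?thesis by blast
  qed
  have parts_perm: "parts (\<alpha> \<circ> \<sigma>) = parts \<alpha>"
  proof -
    have bij: "bij \<sigma>" using \<sigma> by (rule permutes_bij)
    have "\<sigma> ` {k. (\<alpha> \<circ> \<sigma>) k \<noteq> 0} = {k. \<alpha> k \<noteq> 0}"
      using bij by (auto simp: image_iff) (metis bij_pointE)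
    moreover have "inj_on \<sigma> A" for A using bij by (meson bij_is_inj inj_on_subset subset_UNIV)
    ultimately have "mset_set {k. \<alpha> k \<noteq> 0} = image_mset \<sigma> (mset_set {k. (\<alpha> \<circ> \<sigma>) k \<noteq> 0})"
      by (metis image_mset_mset_set)
    then show ?thesis unfolding parts_def by (simp add: multiset.map_comp)
  qed
  show "family_qf n S d (\<alpha> \<circ> \<sigma>) = family_qf n S d \<alpha>"
  proof (cases "exponents n \<alpha>")
    case True
    note True' = exponents_permute[OF \<sigma> True]
    obtain xs where xs: "range (psum \<alpha>) = sums 0 xs" "0 \<notin> set xs" "mset xs = parts \<alpha>" using ex[OF True] by blast
    obtain ys where ys: "range (psum (\<alpha> \<circ> \<sigma>)) = sums 0 ys" "mset ys = parts (\<alpha> \<circ> \<sigma>)" using ex[OF True'] by blast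
    have "sum_list xs = n" using True xs(3) unfolding exponents_def parts_def
      by (metis sum_mset_sum_list sum_unfold_sum_mset)
    then have "card {w \<in> S. d w \<subseteq> sums 0 xs} = card {w \<in> S. d w \<subseteq> sums 0 ys}"
      using xs ys parts_perm by (intro inv) auto
    then show ?thesis using True True' xs(1) ys(1) by (simp add: eq)
  next
    case False
    \<comment> \<open>The inverse permutation would carry the degree condition back to
      \<alpha>.\<close>
    have "\<not> exponents n (\<alpha> \<circ> \<sigma>)"
    proof
      assume "exponents n (\<alpha> \<circ> \<sigma>)"
      then have "exponents n (\<alpha> \<circ> \<sigma> \<circ> inv \<sigma>)" by (rule exponents_permute[OF permutes_inv[OF \<sigma>]])
      then show False using False permutes_inv_o(1)[OF \<sigma>] by (simp add: comp_assoc)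
    qed
    then show ?thesis using False by (simp add: eq)
  qed
qed

section \<open>Enumeration of compositions\<close>

fun compositions :: "nat \<Rightarrow> nat list list" where
  "compositions 0 = [[]]"
| "compositions (Suc n) = concat (map (\<lambda>k. map ((#) (Suc k)) (compositions (n - k))) [0..<Suc n])"

lemma in_compositions:
  assumes "0 \<notin> set xs"
  shows "xs \<in> set (compositions (sum_list xs))"
  using assms
proof (induction xs)
  case (Cons x xs)
  then obtain k where x: "x = Suc k" by (cases x) auto
  have "sum_list (x # xs) = Suc (k + sum_list xs)" using x by simp
  moreover have "xs \<in> set (compositions (k + sum_list xs - k))" using Cons by simp
  ultimately show ?case using x by (simp only: compositions.simps) (force simp: less_Suc_eq_le simp del: upt_Suc)
qed simp

lemma compositions_small: "compositions 1 = [[1]]" "compositions 2 = [[1,1],[2]]"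
  "compositions 3 = [[1,1,1],[1,2],[2,1],[3]]"
  by (simp_all add: numeral_eq_Suc)

lemma compositions_4:
  "compositions 4 = map ((#) 1) (compositions 3) @ map ((#) 2) (compositions 2) @ map ((#) 3) (compositions 1) @ [[4]]"
  by (simp add: numeral_eq_Suc)

lemma compositions_5:
  "compositions 5 = map ((#) 1) (compositions 4) @ map ((#) 2) (compositions 3) @ map ((#) 3) (compositions 2) @ map ((#) 4) (compositions 1) @ [[5]]"
  by (simp add: numeral_eq_Suc)

lemma compositions_6:
  "compositions 6 = map ((#) 1) (compositions 5) @ map ((#) 2) (compositions 4) @ map ((#) 3) (compositions 3) @ map ((#) 4) (compositions 2) @ map ((#) 5) (compositions 1) @ [[6]]"
  by (simp add: numeral_eq_Suc)

lemmas compositions_expand = compositions_6 compositions_5 compositions_4 compositions_small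

lemma mset_length_cong:
  fixes xs ys :: "nat list"
  assumes "mset xs = mset ys"
  shows "sum_list xs = sum_list ys" "length xs = length ys" "set xs = set ys"
  using assms sum_mset_sum_list[of xs] sum_mset_sum_list[of ys] mset_eq_length[OF assms] mset_eq_setD[OF assms] by simp_all

definition count_contained :: "nat list list \<Rightarrow> nat list \<Rightarrow> nat" where
  "count_contained Ds xs = length (filter (\<lambda>D. \<forall>j\<in>set D. j \<in> sums 0 xs) Ds)"

text \<open>Rearrangements of one composition share their sorted list, so comparing each composition
  with its sorted form covers all pairs and leaves a finite evaluation.\<close>

lemma symmetric_if_check:
  assumes d: "\<And>D. D \<in> set Ds \<Longrightarrow> set D \<subseteq> {1..<n}"
    and check: "list_all (\<lambda>xs. count_contained Ds xs = count_contained Ds (sort xs)) (compositions n)"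
  shows "symmetric_fn (family_qf n {..<length Ds} (\<lambda>l. set (Ds ! l)))"
proof (rule symmetric_if_rearrangement_invariant)
  have card: "card {l \<in> {..<length Ds}. set (Ds ! l) \<subseteq> sums 0 xs} = count_contained Ds xs" for xs
    unfolding count_contained_def length_filter_conv_card by (intro arg_cong[where f = card]) auto
  fix xs ys :: "nat list" assume A: "0 \<notin> set xs" "sum_list xs = n" "mset xs = mset ys"
  then have "set xs = set ys" "sum_list ys = n" using mset_length_cong[OF A(3)] by simp_all
  then have "xs \<in> set (compositions n)" "ys \<in> set (compositions n)"
    using A in_compositions[of xs] in_compositions[of ys] by auto
  moreover have "sort xs = sort ys" using A(3) by (intro properties_for_sort) simp_all
  ultimately show "card {l \<in> {..<length Ds}. set (Ds ! l) \<subseteq> sums 0 xs} = card {l \<in> {..<length Ds}. set (Ds ! l) \<subseteq> sums 0 ys}"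
    using check unfolding card list_all_iff by metis
qed (use d in auto)

text \<open>The descent sets of the standard tableaux of shape (2, 2); the next two lists serve (3,
  3) and (2, 2, 2), in the order in which the theorem names the five permutations.\<close>

definition "descents_22 = [[2], [1, 3 :: nat]]"

definition "descents_33 = [[1, 3, 5], [2, 5], [3], [1, 4], [2, 4 :: nat]]"

definition "descents_222 = [[2, 4], [1, 3, 4], [1, 2, 4, 5], [2, 3, 5], [1, 3, 5 :: nat]]"

lemma symmetric_22: "symmetric_fn (family_qf 4 {..<length descents_22} (\<lambda>l. set (descents_22 ! l)))"
proof (rule symmetric_if_check)
  show "list_all (\<lambda>xs. count_contained descents_22 xs = count_contained descents_22 (sort xs)) (compositions 4)"
    unfolding compositions_expand by (simp add: count_contained_def descents_22_def)
qed (auto simp: descents_22_def)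

lemma symmetric_33: "symmetric_fn (family_qf 6 {..<length descents_33} (\<lambda>l. set (descents_33 ! l)))"
proof (rule symmetric_if_check)
  show "list_all (\<lambda>xs. count_contained descents_33 xs = count_contained descents_33 (sort xs)) (compositions 6)"
    unfolding compositions_expand by (simp add: count_contained_def descents_33_def)
qed (auto simp: descents_33_def)

lemma symmetric_222: "symmetric_fn (family_qf 6 {..<length descents_222} (\<lambda>l. set (descents_222 ! l)))"
proof (rule symmetric_if_check)
  show "list_all (\<lambda>xs. count_contained descents_222 xs = count_contained descents_222 (sort xs)) (compositions 6)"
    unfolding compositions_expand by (simp add: count_contained_def descents_222_def)
qed (auto simp: descents_222_def)

section \<open>Counts that depend only on the number of parts\<close>

lemma sums_inner:
  assumes "0 \<notin> set xs" "sum_list xs = n" "1 \<le> n"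
  shows "card ({1..<n} - sums 0 xs) = n - length xs" "card ({1..<n} \<inter> sums 0 xs) = length xs - 1"
    "length xs \<le> n"
proof -
  have sub: "sums 0 xs \<subseteq> {0..n}" "n \<in> sums 0 xs" "0 \<in> sums 0 xs"
    using sums_bounds[of 0 xs] start_in_sums assms by auto
  have fin: "finite (sums 0 xs)" using sub(1) finite_subset by blast
  have "sums 0 xs = insert 0 (insert n ({1..<n} \<inter> sums 0 xs))" using sub by fastforce
  then have "Suc (length xs) = card (insert 0 (insert n ({1..<n} \<inter> sums 0 xs)))"
    using card_sums[OF assms(1), of 0] by metis
  then have 1: "Suc (length xs) = Suc (Suc (card ({1..<n} \<inter> sums 0 xs)))"
    using assms(3) by simp
  then show "card ({1..<n} \<inter> sums 0 xs) = length xs - 1" by simp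
  moreover have "card ({1..<n} \<inter> sums 0 xs) + card ({1..<n} - sums 0 xs) = n - 1"
    using card_Int_Diff[of "{1..<n}" "sums 0 xs"] by simp
  ultimately show "card ({1..<n} - sums 0 xs) = n - length xs" "length xs \<le> n" using 1 assms(3) by linarith+
qed

lemma symmetric_row: "symmetric_fn (family_qf n {{}} (\<lambda>D. D))"
proof (rule symmetric_if_rearrangement_invariant)
  fix xs ys
  have "{D \<in> {{}}. D \<subseteq> X} = {{}}" for X :: "nat set" by blast
  then show "card {D \<in> {{}}. D \<subseteq> sums 0 xs} = card {D \<in> {{}}. D \<subseteq> sums 0 ys}" by simp
qed simp_all

lemma symmetric_column:
  assumes "1 \<le> n"
  shows "symmetric_fn (family_qf n {{1..<n}} (\<lambda>D. D))"
proof (rule symmetric_if_rearrangement_invariant)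
  fix xs ys :: "nat list" assume A: "0 \<notin> set xs" "sum_list xs = n" "mset xs = mset ys"
  have c: "{1..<n} \<subseteq> sums 0 zs \<longleftrightarrow> length zs = n" if "0 \<notin> set zs" "sum_list zs = n" for zs

  proof -
    have "{1..<n} \<subseteq> sums 0 zs \<longleftrightarrow> card ({1..<n} - sums 0 zs) = 0" by simp
    then show ?thesis using sums_inner(1,3)[OF that assms] by linarith
  qed
  have "{1..<n} \<subseteq> sums 0 xs \<longleftrightarrow> {1..<n} \<subseteq> sums 0 ys"
    using c[of xs] c[of ys] A(1,2) mset_length_cong[OF A(3)] by simp
  then have "{D \<in> {{1..<n}}. D \<subseteq> sums 0 xs} = {D \<in> {{1..<n}}. D \<subseteq> sums 0 ys}" by auto
  then show "card {D \<in> {{1..<n}}. D \<subseteq> sums 0 xs} = card {D \<in> {{1..<n}}. D \<subseteq> sums 0 ys}" by simp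
qed auto

lemma symmetric_hook:
  assumes "1 \<le> n"
  shows "symmetric_fn (family_qf n {1..<n} (\<lambda>i. {i}))"
proof (rule symmetric_if_rearrangement_invariant)
  fix xs ys :: "nat list" assume A: "0 \<notin> set xs" "sum_list xs = n" "mset xs = mset ys"
  have c: "card {i \<in> {1..<n}. {i} \<subseteq> sums 0 zs} = length zs - 1" if "0 \<notin> set zs" "sum_list zs = n" for zs
    using sums_inner(2)[OF that assms] by (simp add: Int_def)
  show "card {i \<in> {1..<n}. {i} \<subseteq> sums 0 xs} = card {i \<in> {1..<n}. {i} \<subseteq> sums 0 ys}"
    using c[of xs] c[of ys] A(1,2) mset_length_cong[OF A(3)] by simp
qed auto

text \<open>The set \<open>{1..<n} - {i}\<close> fits when the partial sums miss no inner point
  other than i. The number of missed points is n minus the number of parts, so the count is n - 1, 1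
  or 0 according to whether none, one or more are missed.\<close>

lemma symmetric_cohook:
  assumes "1 \<le> n"
  shows "symmetric_fn (family_qf n {1..<n} (\<lambda>i. {1..<n} - {i}))"
proof (rule symmetric_if_rearrangement_invariant)
  fix xs ys :: "nat list" assume A: "0 \<notin> set xs" "sum_list xs = n" "mset xs = mset ys"
  have c: "card {i \<in> {1..<n}. {1..<n} - {i} \<subseteq> sums 0 zs} =
      (if n - length zs = 0 then n - 1 else if n - length zs = 1 then 1 else 0)"
    if "0 \<notin> set zs" "sum_list zs = n" for zs
  proof -
    let ?X = "{1..<n} - sums 0 zs"
    have X: "{i \<in> {1..<n}. {1..<n} - {i} \<subseteq> sums 0 zs} = {i \<in> {1..<n}. ?X \<subseteq> {i}}" by blast
    consider "card ?X = 0" | "card ?X = 1" | "2 \<le> card ?X" by linarith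
    then show ?thesis
    proof cases
      case 1
      then have "?X = {}" by simp
      then have "{i \<in> {1..<n}. ?X \<subseteq> {i}} = {1..<n}" by blast
      then show ?thesis unfolding X sums_inner(1)[OF that assms, symmetric] using 1 by simp
    next
      case 2
      then obtain j where j: "?X = {j}" by (auto simp: card_1_singleton_iff)
      then have "{i \<in> {1..<n}. ?X \<subseteq> {i}} = {j}" by blast
      then show ?thesis unfolding X sums_inner(1)[OF that assms, symmetric] using 2 by simp
    next
      case 3
      have "\<not> ?X \<subseteq> {i}" for i
      proof
        assume "?X \<subseteq> {i}"
        then have "card ?X \<le> 1" by (metis card.empty card_mono finite.emptyI finite_insert is_singletonI is_singleton_altdef)
        then show False using 3 by simp
      qed
      then have e: "{i \<in> {1..<n}. ?X \<subseteq> {i}} = {}" by blast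
      have "card ?X \<noteq> 0" "card ?X \<noteq> 1" using 3 by linarith+
      then show ?thesis unfolding X e sums_inner(1)[OF that assms, symmetric] by (simp only: if_False card.empty)
    qed
  qed
  show "card {i \<in> {1..<n}. {1..<n} - {i} \<subseteq> sums 0 xs} = card {i \<in> {1..<n}. {1..<n} - {i} \<subseteq> sums 0 ys}"
    using c[of xs] c[of ys] A(1,2) mset_length_cong[OF A(3)] by simp
qed auto

section \<open>Schur functions of particular shapes\<close>

definition fillings :: "(nat \<times> nat) set \<Rightarrow> (nat \<times> nat \<Rightarrow> nat) set" where
  "fillings C = {T. (\<forall>x. x \<notin> C \<longrightarrow> T x = 0) \<and> (\<forall>x\<in>C. 1 \<le> T x)}"

text \<open>Intended for p listing the cells in the order of the entries of a standard tableau and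
  \<open>D\<close> its descent set; the fillings are then the P-partitions of a labelled
  chain.\<close>

definition ascending :: "nat \<Rightarrow> nat set \<Rightarrow> (nat \<Rightarrow> nat \<times> nat) \<Rightarrow> (nat \<times> nat \<Rightarrow> nat) \<Rightarrow> bool" where
  "ascending n D p T \<longleftrightarrow> (\<forall>j\<in>{1..n-1}. T (p j) \<le> T (p (Suc j))) \<and> (\<forall>j\<in>D. T (p j) < T (p (Suc j)))"

text \<open>Reading a filling along p gives a word with the same content, and the inverse of p
  writes a word back into the shape.\<close>

lemma bij_betw_ascending_words:
  assumes p: "bij_betw p {1..n} C" and D: "D \<subseteq> {1..<n}"
  shows "bij_betw (\<lambda>T j. if j \<in> {1..n} then T (p j) else 0)
    {T \<in> fillings C. ascending n D p T \<and> (\<forall>k. card {x \<in> C. T x = k} = \<alpha> k)} (words n D \<alpha>)"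
    (is "bij_betw ?f ?A _")
proof -
  define q where "q = the_inv_into {1..n} p"
  have inj: "inj_on p {1..n}" and img: "p ` {1..n} = C" using p by (auto simp: bij_betw_def)
  have qp: "q (p j) = j" if "j \<in> {1..n}" for j unfolding q_def by (rule the_inv_into_f_f[OF inj that])
  have pq: "p (q x) = x" "q x \<in> {1..n}" if "x \<in> C" for x
    using qp that img by auto
  have pC: "p j \<in> C" if "j \<in> {1..n}" for j using that img by blast
  have content: "card {x \<in> C. T x = k} = card {j \<in> {1..n}. T (p j) = k}" for T :: "nat \<times> nat \<Rightarrow> nat" and k
  proof -
    have "{x \<in> C. T x = k} = p ` {j \<in> {1..n}. T (p j) = k}" using img by auto
    moreover have "inj_on p {j \<in> {1..n}. T (p j) = k}" by (rule inj_on_subset[OF inj]) auto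
    ultimately show ?thesis by (simp add: card_image)
  qed
  have Sj: "j \<in> {1..n}" "Suc j \<in> {1..n}" if "j \<in> {1..n-1}" for j using that by auto
  have Dj: "j \<in> {1..n}" "Suc j \<in> {1..n}" if "j \<in> D" for j using that D by auto
  show ?thesis
  proof (rule bij_betw_byWitness[where f' = "\<lambda>i x. if x \<in> C then i (q x) else 0"])
    show "\<forall>T\<in>?A. (\<lambda>x. if x \<in> C then ?f T (q x) else 0) = T"
    proof
      fix T assume "T \<in> ?A"
      then have "T x = 0" if "x \<notin> C" for x using that unfolding fillings_def by blast
      then have "(if x \<in> C then ?f T (q x) else 0) = T x" for x
        using pq[of x] by (simp del: atLeastAtMost_iff)
      then show "(\<lambda>x. if x \<in> C then ?f T (q x) else 0) = T" by (rule ext)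
    qed
    show "\<forall>i\<in>words n D \<alpha>. ?f (\<lambda>x. if x \<in> C then i (q x) else 0) = i"
      by (auto simp: words_def fun_eq_iff pC qp simp del: atLeastAtMost_iff)
    show "?f ` ?A \<subseteq> words n D \<alpha>"
    proof
      fix i assume "i \<in> ?f ` ?A"
      then obtain T where T: "T \<in> ?A" "i = ?f T" by blast
      have "{j \<in> {1..n}. i j = k} = {j \<in> {1..n}. T (p j) = k}" for k unfolding T(2) by auto
      then have "card {j \<in> {1..n}. i j = k} = \<alpha> k" for k using T(1) content by simp
      then show "i \<in> words n D \<alpha>" using T Sj Dj pC unfolding words_def fillings_def ascending_def
        by (simp del: atLeastAtMost_iff)
    qed
    show "(\<lambda>i x. if x \<in> C then i (q x) else 0) ` words n D \<alpha> \<subseteq> ?A"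
    proof
      fix T assume "T \<in> (\<lambda>i x. if x \<in> C then i (q x) else 0) ` words n D \<alpha>"
      then obtain i where i: "i \<in> words n D \<alpha>" "T = (\<lambda>x. if x \<in> C then i (q x) else 0)" by blast
      have Tp: "T (p j) = i j" if "j \<in> {1..n}" for j using that i(2) pC qp by simp
      have "{j \<in> {1..n}. T (p j) = k} = {j \<in> {1..n}. i j = k}" for k using Tp by auto
      then have "card {x \<in> C. T x = k} = \<alpha> k" for k using i(1) unfolding content words_def by simp
      moreover have "T \<in> fillings C" using i pq(2) unfolding fillings_def words_def by simp
      moreover have "ascending n D p T" using i(1) Tp Sj Dj unfolding ascending_def words_def
        by (simp del: atLeastAtMost_iff)
      ultimately show "T \<in> ?A" by blast
    qed
  qed
qed

text \<open>Standardization: the semistandard tableaux of a given shape are the disjoint union, over the standard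
  tableaux \<open>p\<close>, of the fillings that increase along \<open>p\<close>, strictly at its descents.\<close>

lemma schur_eq_family_qf:
  assumes fin: "finite I" and p: "\<And>l. l \<in> I \<Longrightarrow> bij_betw (p l) {1..n} (cells lam)"
    and D: "\<And>l. l \<in> I \<Longrightarrow> D l \<subseteq> {1..<n}"
    and ex: "\<And>T. T \<in> fillings (cells lam) \<Longrightarrow> is_SSYT lam T \<longleftrightarrow> (\<exists>l\<in>I. ascending n (D l) (p l) T)"
    and uniq: "\<And>T l l'. \<lbrakk>l \<in> I; l' \<in> I; ascending n (D l) (p l) T; ascending n (D l') (p l') T\<rbrakk> \<Longrightarrow> l = l'"
  shows "schur lam = family_qf n I D"
proof
  fix \<alpha>
  define A where "A = (\<lambda>l. {T \<in> fillings (cells lam). ascending n (D l) (p l) T \<and> (\<forall>k. card {x \<in> cells lam. T x = k} = \<alpha> k)})"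
  have "is_SSYT lam T \<Longrightarrow> T \<in> fillings (cells lam)" for T unfolding is_SSYT_def fillings_def by blast
  then have "{T. is_SSYT lam T \<and> (\<forall>k. card {x \<in> cells lam. T x = k} = \<alpha> k)} = (\<Union>l\<in>I. A l)"
    unfolding A_def using ex by blast
  moreover have bij: "bij_betw (\<lambda>T j. if j \<in> {1..n} then T (p l j) else 0) (A l) (words n (D l) \<alpha>)" if "l \<in> I" for l
    unfolding A_def using that p D by (intro bij_betw_ascending_words)
  then have "finite (A l)" if "l \<in> I" for l using that finite_words bij_betw_finite by blast
  then have "card (\<Union>l\<in>I. A l) = (\<Sum>l\<in>I. card (A l))"
    using fin uniq by (intro card_UN_disjoint) (auto simp: A_def)
  moreover have "int (card (A l)) = Fqs n (D l) \<alpha>" if "l \<in> I" for l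
    unfolding Fqs_words using bij_betw_same_card[OF bij[OF that]] by simp
  ultimately show "schur lam \<alpha> = family_qf n I D \<alpha>" unfolding schur_def family_qf_def by simp
qed

lemma bij_betw_nth_pred:
  assumes "distinct xs"
  shows "bij_betw (\<lambda>j. xs ! (j - 1)) {1..length xs} (set xs)"
proof -
  have "bij_betw (\<lambda>j. j - 1) {1..length xs} {..<length xs}"
    by (rule bij_betw_byWitness[where f' = Suc]) auto
  from bij_betw_trans[OF this bij_betw_nth[OF assms refl refl]] show ?thesis by (simp add: comp_def)
qed

lemma is_SSYT_fillings: "T \<in> fillings (cells lam) \<Longrightarrow> is_SSYT lam T \<longleftrightarrow>
   (\<forall>r c. (r, Suc c) \<in> cells lam \<longrightarrow> T (r, c) \<le> T (r, Suc c)) \<and>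
   (\<forall>r c. (Suc r, c) \<in> cells lam \<longrightarrow> T (r, c) < T (Suc r, c))"
  unfolding is_SSYT_def fillings_def by blast

lemma cells_Nil: "cells [] = {}"
  unfolding cells_def by simp

lemma cells_Cons: "cells (x # xs) = {0} \<times> {..<x} \<union> map_prod Suc id ` cells xs"
proof (intro set_eqI iffI)
  fix y assume "y \<in> cells (x # xs)"
  then obtain r c where y: "y = (r, c)" "r < Suc (length xs)" "c < (x # xs) ! r" unfolding cells_def by auto
  show "y \<in> {0} \<times> {..<x} \<union> map_prod Suc id ` cells xs"
  proof (cases r)
    case (Suc r')
    then have "(r', c) \<in> cells xs" using y unfolding cells_def by simp
    then show ?thesis using y(1) Suc by force
  qed (use y in simp)
qed (auto simp: cells_def)

section \<open>One row, one column and hooks\<close>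

lemma schur_row: "schur [n] = family_qf n {{}} (\<lambda>D. D)"
proof (rule schur_eq_family_qf[where p = "\<lambda>_ j. (0, j - 1)"])
  have cells: "cells [n] = {0} \<times> {..<n}" by (simp add: cells_Cons cells_Nil)
  show "bij_betw (\<lambda>j. (0, j - 1)) {1..n} (cells [n])" unfolding cells
    by (rule bij_betw_byWitness[where f' = "\<lambda>x. Suc (snd x)"]) auto
  fix T assume T: "T \<in> fillings (cells [n])"
  have "(\<forall>c. Suc c < n \<longrightarrow> T (0, c) \<le> T (0, Suc c)) \<longleftrightarrow> (\<forall>j\<in>{1..n-1}. T (0, j - 1) \<le> T (0, j))"
  proof
    assume a: "\<forall>c. Suc c < n \<longrightarrow> T (0, c) \<le> T (0, Suc c)"
    show "\<forall>j\<in>{1..n-1}. T (0, j - 1) \<le> T (0, j)"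
    proof
      fix j assume "j \<in> {1..n-1}"
      then show "T (0, j - 1) \<le> T (0, j)" using a[rule_format, of "j - 1"] by auto
    qed
  next
    assume a: "\<forall>j\<in>{1..n-1}. T (0, j - 1) \<le> T (0, j)"
    show "\<forall>c. Suc c < n \<longrightarrow> T (0, c) \<le> T (0, Suc c)"
    proof (intro allI impI)
      fix c assume "Suc c < n"
      then show "T (0, c) \<le> T (0, Suc c)" using a[rule_format, of "Suc c"] by auto
    qed
  qed
  then show "is_SSYT [n] T \<longleftrightarrow> (\<exists>l\<in>{{}}. ascending n l (\<lambda>j. (0, j - 1)) T)"
    unfolding is_SSYT_fillings[OF T] ascending_def cells by simp
qed auto

lemma cells_replicate: "cells (replicate m 1) = {..<m} \<times> {0}"
  unfolding cells_def by auto

lemma schur_column: "schur (replicate n 1) = family_qf n {{1..<n}} (\<lambda>D. D)"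
proof (rule schur_eq_family_qf[where p = "\<lambda>_ j. (j - 1, 0)"])
  show "bij_betw (\<lambda>j. (j - 1, 0)) {1..n} (cells (replicate n 1))" unfolding cells_replicate
    by (rule bij_betw_byWitness[where f' = "\<lambda>x. Suc (fst x)"]) auto
  fix T assume T: "T \<in> fillings (cells (replicate n 1))"
  have "(\<forall>r. Suc r < n \<longrightarrow> T (r, 0) < T (Suc r, 0)) \<longleftrightarrow> (\<forall>j\<in>{1..<n}. T (j - 1, 0) < T (j, 0))"
  proof
    assume a: "\<forall>r. Suc r < n \<longrightarrow> T (r, 0) < T (Suc r, 0)"
    show "\<forall>j\<in>{1..<n}. T (j - 1, 0) < T (j, 0)"
    proof
      fix j assume "j \<in> {1..<n}"
      then show "T (j - 1, 0) < T (j, 0)" using a[rule_format, of "j - 1"] by auto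
    qed
  next
    assume a: "\<forall>j\<in>{1..<n}. T (j - 1, 0) < T (j, 0)"
    show "\<forall>r. Suc r < n \<longrightarrow> T (r, 0) < T (Suc r, 0)"
    proof (intro allI impI)
      fix r assume "Suc r < n"
      then show "T (r, 0) < T (Suc r, 0)" using a[rule_format, of "Suc r"] by auto
    qed
  qed
  moreover have "\<forall>j\<in>{1..n-1}. T (j - 1, 0) \<le> T (j, 0)" if "\<forall>j\<in>{1..<n}. T (j - 1, 0) < T (j, 0)"
  proof
    fix j assume "j \<in> {1..n-1}"
    then have "j \<in> {1..<n}" by auto
    then show "T (j - 1, 0) \<le> T (j, 0)" using that by (simp add: less_imp_le)
  qed
  ultimately show "is_SSYT (replicate n 1) T \<longleftrightarrow> (\<exists>l\<in>{{1..<n}}. ascending n l (\<lambda>j. (j - 1, 0)) T)"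
    unfolding is_SSYT_fillings[OF T] ascending_def cells_replicate by auto
qed auto

text \<open>The standard tableau with index i fills i cells of the row, then (1, 0), then the rest
  of the row; its descent set is {i}. A semistandard \<open>T\<close> belongs to the i that counts
  the row entries below \<open>T (1, 0)\<close>, which gives both existence and uniqueness.\<close>

lemma schur_hook:
  assumes n: "2 \<le> n"
  shows "schur [n - 1, 1] = family_qf n {1..<n} (\<lambda>i. {i})"
proof (rule schur_eq_family_qf[where p = "\<lambda>i j. if j \<le> i then (0, j - 1) else if j = Suc i then (1, 0) else (0, j - 2)"])
  let ?p = "\<lambda>i j. if j \<le> i then (0, j - 1) else if j = Suc i then (1, 0) else (0, j - 2 :: nat) :: nat \<times> nat"
  have cells: "cells [n - 1, 1] = insert (1, 0) ({0} \<times> {..<n - 1})"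
    unfolding cells_def by (auto simp: less_Suc_eq)
  show "bij_betw (?p i) {1..n} (cells [n - 1, 1])" if "i \<in> {1..<n}" for i
    unfolding cells
    by (rule bij_betw_byWitness[where f' = "\<lambda>(r, c). if r = 1 then Suc i else if c < i then Suc c else c + 2"])
      (use that in auto)
  have row: "T (0, c) \<le> T (0, c')"
    if a: "ascending n {i} (?p i) T" and i: "i \<in> {1..<n}" and c: "c \<le> c'" "c' < n - 1" for T i c c'
    using c
  proof (induction c' rule: dec_induct)
    case (step m)
    have le: "T (?p i j) \<le> T (?p i (Suc j))" if "j \<in> {1..n-1}" for j
      using a that unfolding ascending_def by blast
    have "T (0, m) \<le> T (0, Suc m)"
    proof -
      consider "Suc m < i" | "Suc m = i" | "i \<le> m" by linarith
      then show ?thesis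
      proof cases
        case 1
        then show ?thesis using le[of "Suc m"] step.prems by simp
      next
        case 2
        \<comment> \<open>Here the cell (1, 0) is read between the two row cells, so two steps along
          p are chained.\<close>
        then show ?thesis using le[of i] le[of "Suc i"] i step.prems by auto
      next
        case 3
        then show ?thesis using le[of "m + 2"] i step.prems by auto
      qed
    qed
    then show ?case using step by simp
  qed simp
  have drop: "T (0, i - 1) < T (1, 0)" if "ascending n {i} (?p i) T" "i \<in> {1..<n}" for T i
    using that unfolding ascending_def by simp
  have rise: "T (1, 0) \<le> T (0, i)" if "ascending n {i} (?p i) T" "i \<in> {1..<n}" "Suc i < n" for T i
  proof -
    have "Suc i \<in> {1..n-1}" using that by auto
    then have "T (?p i (Suc i)) \<le> T (?p i (Suc (Suc i)))" using that(1) unfolding ascending_def by blast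
    then show ?thesis by simp
  qed
  show "is_SSYT [n - 1, 1] T \<longleftrightarrow> (\<exists>i\<in>{1..<n}. ascending n {i} (?p i) T)" if T: "T \<in> fillings (cells [n - 1, 1])" for T
  proof
    assume "is_SSYT [n - 1, 1] T"
    then have weak: "\<And>c. Suc c < n - 1 \<Longrightarrow> T (0, c) \<le> T (0, Suc c)" and strict: "T (0, 0) < T (1, 0)"
      unfolding is_SSYT_fillings[OF T] cells using n by auto
    \<comment> \<open>The maximum of \<open>K\<close> is the place where standardization inserts the
      entry of the second row.\<close>
    define K where "K = {k \<in> {1..<n}. T (0, k - 1) < T (1, 0)}"
    have K: "finite K" "1 \<in> K" using strict n unfolding K_def by auto
    define i where "i = Max K"
    have i: "i \<in> K" unfolding i_def using K by (intro Max_in) auto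
    have above: "T (1, 0) \<le> T (0, i)" if "Suc i < n"
    proof (rule ccontr)
      assume "\<not> ?thesis"
      then have "Suc i \<in> K" using that unfolding K_def by simp
      then have "Suc i \<le> i" using Max_ge[OF K(1)] unfolding i_def by blast
      then show False by simp
    qed
    have "T (?p i j) \<le> T (?p i (Suc j))" if j: "j \<in> {1..n-1}" for j
    proof -
      consider "j < i" | "j = i" | "j = Suc i" | "i + 2 \<le> j" by linarith
      then show ?thesis
      proof cases
        case 1
        then show ?thesis using weak[of "j - 1"] j i unfolding K_def by auto
      next
        case 2
        then show ?thesis using i unfolding K_def by simp
      next
        case 3
        then show ?thesis using above j by auto
      next
        case 4
        then have "T (0, j - 2) \<le> T (0, Suc (j - 2))" using j by (intro weak) auto
        moreover have "Suc (j - 2) = Suc j - 2" using 4 by simp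
        ultimately show ?thesis using 4 by simp
      qed
    qed
    moreover have "T (?p i i) < T (?p i (Suc i))" using i unfolding K_def by simp
    ultimately have "ascending n {i} (?p i) T" unfolding ascending_def by blast
    then show "\<exists>i\<in>{1..<n}. ascending n {i} (?p i) T" using i unfolding K_def by blast
  next
    assume "\<exists>i\<in>{1..<n}. ascending n {i} (?p i) T"
    then obtain i where i: "i \<in> {1..<n}" "ascending n {i} (?p i) T" by blast
    have "T (0, 0) \<le> T (0, i - 1)" using i(1) by (intro row[OF i(2,1)]) auto
    then have "T (0, 0) < T (1, 0)" using drop[OF i(2,1)] by simp
    moreover have "T (0, c) \<le> T (0, Suc c)" if "Suc c < n - 1" for c using row[OF i(2,1)] that by simp
    ultimately show "is_SSYT [n - 1, 1] T" unfolding is_SSYT_fillings[OF T] cells by auto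
  qed
  show "i = i'" if i: "i \<in> {1..<n}" "i' \<in> {1..<n}" and a: "ascending n {i} (?p i) T" "ascending n {i'} (?p i') T" for T i i'
  proof -
    have "\<not> k < k'" if k: "k \<in> {1..<n}" "k' \<in> {1..<n}" and b: "ascending n {k} (?p k) T" "ascending n {k'} (?p k') T" for k k'
    proof
      assume lt: "k < k'"
      have "T (1, 0) \<le> T (0, k)" using k lt by (intro rise[OF b(1)]) auto
      also have "\<dots> \<le> T (0, k' - 1)" using k lt by (intro row[OF b(1)]) auto
      also have "\<dots> < T (1, 0)" by (rule drop[OF b(2) k(2)])
      finally show False by simp
    qed
    then show ?thesis using i a by (meson nat_neq_iff)
  qed
qed auto

text \<open>Transpose of the hook case, with weak and strict inequalities exchanged: i counts the
  entries of the first column that are at most \<open>T (0, 1)\<close>, and i is the only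
  non-descent.\<close>

lemma schur_cohook:
  assumes n: "2 \<le> n"
  shows "schur (2 # replicate (n - 2) 1) = family_qf n {1..<n} (\<lambda>i. {1..<n} - {i})"
proof (rule schur_eq_family_qf[where p = "\<lambda>i j. if j \<le> i then (j - 1, 0) else if j = Suc i then (0, 1) else (j - 2, 0)"])
  let ?lam = "2 # replicate (n - 2) 1"
  let ?p = "\<lambda>i j. if j \<le> i then (j - 1, 0) else if j = Suc i then (0, 1) else (j - 2 :: nat, 0) :: nat \<times> nat"
  have cells: "cells ?lam = insert (0, 1) ({..<n - 1} \<times> {0})"
  proof -
    have "map_prod Suc id ` ({..<n - 2} \<times> {0 :: nat}) = {1..<n - 1} \<times> {0}"
    proof (intro set_eqI iffI)
      fix x assume "x \<in> {1..<n - 1} \<times> {0 :: nat}"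
      then have "x = map_prod Suc id (fst x - 1, 0)" "(fst x - 1, 0) \<in> {..<n - 2} \<times> {0 :: nat}" by auto
      then show "x \<in> map_prod Suc id ` ({..<n - 2} \<times> {0})" by blast
    qed auto
    then show ?thesis unfolding cells_Cons cells_replicate using n by (auto simp: numeral_2_eq_2 less_Suc_eq)
  qed
  show "bij_betw (?p i) {1..n} (cells ?lam)" if "i \<in> {1..<n}" for i
    unfolding cells
    by (rule bij_betw_byWitness[where f' = "\<lambda>(r, c). if c = 1 then Suc i else if r < i then Suc r else r + 2"])
      (use that in auto)
  have lt: "T (?p i j) < T (?p i (Suc j))"
    if "ascending n ({1..<n} - {i}) (?p i) T" "j \<in> {1..<n}" "j \<noteq> i" for T i j
    using that unfolding ascending_def by blast
  have rise: "T (i - 1, 0) \<le> T (0, 1)" if a: "ascending n ({1..<n} - {i}) (?p i) T" and i: "i \<in> {1..<n}" for T i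
  proof -
    have "i \<in> {1..n-1}" using i by auto
    then have "T (?p i i) \<le> T (?p i (Suc i))" using a unfolding ascending_def by blast
    then show ?thesis by simp
  qed
  have drop: "T (0, 1) < T (i, 0)" if "ascending n ({1..<n} - {i}) (?p i) T" "i \<in> {1..<n}" "Suc i < n" for T i
    using lt[OF that(1), of "Suc i"] that(2,3) by simp
  have column: "T (c, 0) < T (Suc c, 0)"
    if a: "ascending n ({1..<n} - {i}) (?p i) T" and i: "i \<in> {1..<n}" and c: "Suc c < n - 1" for T i c
  proof -
    consider "Suc c < i" | "Suc c = i" | "i \<le> c" by linarith
    then show ?thesis
    proof cases
      case 1
      then show ?thesis using lt[OF a, of "Suc c"] c by simp
    next
      case 2
      then have "Suc i < n" using c by simp
      then show ?thesis using rise[OF a i] drop[OF a i] 2 by auto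
    next
      case 3
      then show ?thesis using lt[OF a, of "c + 2"] i c by simp
    qed
  qed
  have column_le: "T (c, 0) \<le> T (c', 0)"
    if a: "ascending n ({1..<n} - {i}) (?p i) T" and i: "i \<in> {1..<n}" and c: "c \<le> c'" "c' < n - 1" for T i c c'
    using c
  proof (induction c' rule: dec_induct)
    case (step m)
    then show ?case using column[OF a i, of m] by simp
  qed simp
  show "is_SSYT ?lam T \<longleftrightarrow> (\<exists>i\<in>{1..<n}. ascending n ({1..<n} - {i}) (?p i) T)" if T: "T \<in> fillings (cells ?lam)" for T
  proof
    assume "is_SSYT ?lam T"
    then have strict: "\<And>c. Suc c < n - 1 \<Longrightarrow> T (c, 0) < T (Suc c, 0)" and weak: "T (0, 0) \<le> T (0, 1)"
      unfolding is_SSYT_fillings[OF T] cells using n by auto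
    define K where "K = {k \<in> {1..<n}. T (k - 1, 0) \<le> T (0, 1)}"
    have K: "finite K" "1 \<in> K" using weak n unfolding K_def by auto
    define i where "i = Max K"
    have i: "i \<in> K" unfolding i_def using K by (intro Max_in) auto
    have above: "T (0, 1) < T (i, 0)" if "Suc i < n"
    proof (rule ccontr)
      assume "\<not> ?thesis"
      then have "Suc i \<in> K" using that unfolding K_def by simp
      then have "Suc i \<le> i" using Max_ge[OF K(1)] unfolding i_def by blast
      then show False by simp
    qed
    have less: "T (?p i j) < T (?p i (Suc j))" if j: "j \<in> {1..<n}" "j \<noteq> i" for j
    proof -
      consider "j < i" | "j = Suc i" | "i + 2 \<le> j" using j(2) by linarith
      then show ?thesis
      proof cases
        case 1
        then show ?thesis using strict[of "j - 1"] j i unfolding K_def by auto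
      next
        case 2
        then show ?thesis using above j by auto
      next
        case 3
        then have "T (j - 2, 0) < T (Suc (j - 2), 0)" using j by (intro strict) auto
        moreover have "Suc (j - 2) = Suc j - 2" using 3 by simp
        ultimately show ?thesis using 3 by simp
      qed
    qed
    moreover have "T (?p i j) \<le> T (?p i (Suc j))" if j: "j \<in> {1..n-1}" for j
    proof (cases "j = i")
      case True
      then show ?thesis using i unfolding K_def by simp
    next
      case False
      then show ?thesis using j by (intro less_imp_le[OF less]) auto
    qed
    ultimately have "ascending n ({1..<n} - {i}) (?p i) T" unfolding ascending_def by blast
    then show "\<exists>i\<in>{1..<n}. ascending n ({1..<n} - {i}) (?p i) T" using i unfolding K_def by blast
  next
    assume "\<exists>i\<in>{1..<n}. ascending n ({1..<n} - {i}) (?p i) T"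
    then obtain i where i: "i \<in> {1..<n}" "ascending n ({1..<n} - {i}) (?p i) T" by blast
    have "T (0, 0) \<le> T (i - 1, 0)" using i(1) by (intro column_le[OF i(2,1)]) auto
    then have "T (0, 0) \<le> T (0, 1)" using rise[OF i(2,1)] by simp
    then show "is_SSYT ?lam T" using column[OF i(2,1)] unfolding is_SSYT_fillings[OF T] cells by auto
  qed
  show "i = i'" if i: "i \<in> {1..<n}" "i' \<in> {1..<n}"
    and a: "ascending n ({1..<n} - {i}) (?p i) T" "ascending n ({1..<n} - {i'}) (?p i') T" for T i i'
  proof -
    have "\<not> k < k'" if k: "k \<in> {1..<n}" "k' \<in> {1..<n}"
      and b: "ascending n ({1..<n} - {k}) (?p k) T" "ascending n ({1..<n} - {k'}) (?p k') T" for k k'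
    proof
      assume lt: "k < k'"
      have "T (0, 1) < T (k, 0)" using k lt by (intro drop[OF b(1)]) auto
      also have "\<dots> \<le> T (k' - 1, 0)" using k lt by (intro column_le[OF b(1)]) auto
      also have "\<dots> \<le> T (0, 1)" by (rule rise[OF b(2) k(2)])
      finally show False by simp
    qed
    then show ?thesis using i a by (meson nat_neq_iff)
  qed
qed auto

section \<open>The shapes (2, 2), (3, 3) and (2, 2, 2)\<close>

lemma schur_22: "schur [2, 2] = family_qf 4 {..<length descents_22} (\<lambda>l. set (descents_22 ! l))"
proof -
  \<comment> \<open>Each standard tableau is the list of its cells in the order of the entries,
    placed at the index of its descent set in \<open>descents_22\<close>. Entries start at 1 and
    list positions at 0, hence \<open>j - 1\<close> below.\<close>
  define Ps :: "(nat \<times> nat) list list" where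
    "Ps = [[(0,0), (0,1), (1,0), (1,1)],
      [(0,0), (1,0), (0,1), (1,1)]]"
  let ?asc = "\<lambda>l. ascending 4 (set (descents_22 ! l)) (\<lambda>j. Ps ! l ! (j - 1))"
  have I: "{..<length descents_22} = {0 :: nat, 1}" by (auto simp: descents_22_def)
  have J: "{1..4 - 1 :: nat} = {1, 2, 3}" by auto
  have cells: "cells [2, 2] = {(0,0), (0,1), (1,0), (1,1)}"
    by (auto simp: cells_Cons cells_Nil numeral_eq_Suc lessThan_Suc)
  have SSYT: "is_SSYT [2, 2] T \<longleftrightarrow>
      T (0,0) \<le> T (0,1) \<and> T (1,0) \<le> T (1,1) \<and> T (0,0) < T (1,0) \<and> T (0,1) < T (1,1)"
    if "T \<in> fillings (cells [2, 2])" for T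
    unfolding is_SSYT_fillings[OF that] cells by (auto simp: numeral_2_eq_2)
  have asc: "?asc 0 T \<longleftrightarrow> T (0,0) \<le> T (0,1) \<and> T (0,1) < T (1,0) \<and> T (1,0) \<le> T (1,1)"
    "?asc 1 T \<longleftrightarrow> T (0,0) < T (1,0) \<and> T (1,0) \<le> T (0,1) \<and> T (0,1) < T (1,1)" for T
    unfolding ascending_def J by (auto simp: descents_22_def Ps_def)
  show ?thesis
  proof (rule schur_eq_family_qf[where p = "\<lambda>l j. Ps ! l ! (j - 1)"])
    show "bij_betw (\<lambda>j. Ps ! l ! (j - 1)) {1..4} (cells [2, 2])" if "l \<in> {..<length descents_22}" for l
    proof -
      have "distinct (Ps ! l)" "length (Ps ! l) = 4" "set (Ps ! l) = cells [2, 2]"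
        using that unfolding I cells by (auto simp: Ps_def)
      then show ?thesis using bij_betw_nth_pred[of "Ps ! l"] by simp
    qed
    \<comment> \<open>The values at the cells (0, 1) and (1, 0), which the shape leaves uncompared,
      select the chain.\<close>
    show "is_SSYT [2, 2] T \<longleftrightarrow> (\<exists>l\<in>{..<length descents_22}. ?asc l T)" if "T \<in> fillings (cells [2, 2])" for T
      unfolding SSYT[OF that] I bex_simps asc by auto
    show "l = l'" if "l \<in> {..<length descents_22}" "l' \<in> {..<length descents_22}" "?asc l T" "?asc l' T" for T l l'
      using that unfolding I by (elim insertE emptyE; hypsubst; simp only: asc; linarith)
  qed (auto simp: descents_22_def nth_Cons split: nat.splits)
qed

lemma schur_33: "schur [3, 3] = family_qf 6 {..<length descents_33} (\<lambda>l. set (descents_33 ! l))"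
proof -
  define Ps :: "(nat \<times> nat) list list" where
    "Ps = [[(0,0), (1,0), (0,1), (1,1), (0,2), (1,2)],
      [(0,0), (0,1), (1,0), (1,1), (0,2), (1,2)],
      [(0,0), (0,1), (0,2), (1,0), (1,1), (1,2)],
      [(0,0), (1,0), (0,1), (0,2), (1,1), (1,2)],
      [(0,0), (0,1), (1,0), (0,2), (1,1), (1,2)]]"
  let ?asc = "\<lambda>l. ascending 6 (set (descents_33 ! l)) (\<lambda>j. Ps ! l ! (j - 1))"
  have I: "{..<length descents_33} = {0 :: nat, 1, 2, 3, 4}" by (auto simp: descents_33_def)
  have J: "{1..6 - 1 :: nat} = {1, 2, 3, 4, 5}" by auto
  have cells: "cells [3, 3] = {(0,0), (0,1), (0,2), (1,0), (1,1), (1,2)}"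
    by (auto simp: cells_Cons cells_Nil numeral_eq_Suc lessThan_Suc)
  have SSYT: "is_SSYT [3, 3] T \<longleftrightarrow>
      T (0,0) \<le> T (0,1) \<and> T (0,1) \<le> T (0,2) \<and> T (1,0) \<le> T (1,1) \<and> T (1,1) \<le> T (1,2) \<and> T (0,0) < T (1,0) \<and> T (0,1) < T (1,1) \<and> T (0,2) < T (1,2)"
    if "T \<in> fillings (cells [3, 3])" for T
    unfolding is_SSYT_fillings[OF that] cells by (auto simp: numeral_2_eq_2)
  \<comment> \<open>One chain for each standard tableau. The strict steps break ties between cells
    that the shape leaves uncompared, so the chains exclude one another.\<close>
  have asc: "?asc 0 T \<longleftrightarrow> T (0,0) < T (1,0) \<and> T (1,0) \<le> T (0,1) \<and> T (0,1) < T (1,1) \<and> T (1,1) \<le> T (0,2) \<and> T (0,2) < T (1,2)"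
    "?asc 1 T \<longleftrightarrow> T (0,0) \<le> T (0,1) \<and> T (0,1) < T (1,0) \<and> T (1,0) \<le> T (1,1) \<and> T (1,1) \<le> T (0,2) \<and> T (0,2) < T (1,2)"
    "?asc 2 T \<longleftrightarrow> T (0,0) \<le> T (0,1) \<and> T (0,1) \<le> T (0,2) \<and> T (0,2) < T (1,0) \<and> T (1,0) \<le> T (1,1) \<and> T (1,1) \<le> T (1,2)"
    "?asc 3 T \<longleftrightarrow> T (0,0) < T (1,0) \<and> T (1,0) \<le> T (0,1) \<and> T (0,1) \<le> T (0,2) \<and> T (0,2) < T (1,1) \<and> T (1,1) \<le> T (1,2)"
    "?asc 4 T \<longleftrightarrow> T (0,0) \<le> T (0,1) \<and> T (0,1) < T (1,0) \<and> T (1,0) \<le> T (0,2) \<and> T (0,2) < T (1,1) \<and> T (1,1) \<le> T (1,2)" for T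
    unfolding ascending_def J by (auto simp: descents_33_def Ps_def)
  show ?thesis
  proof (rule schur_eq_family_qf[where p = "\<lambda>l j. Ps ! l ! (j - 1)"])
    show "bij_betw (\<lambda>j. Ps ! l ! (j - 1)) {1..6} (cells [3, 3])" if "l \<in> {..<length descents_33}" for l
    proof -
      have "distinct (Ps ! l)" "length (Ps ! l) = 6" "set (Ps ! l) = cells [3, 3]"
        using that unfolding I cells by (auto simp: Ps_def)
      then show ?thesis using bij_betw_nth_pred[of "Ps ! l"] by simp
    qed
    show "is_SSYT [3, 3] T \<longleftrightarrow> (\<exists>l\<in>{..<length descents_33}. ?asc l T)" if "T \<in> fillings (cells [3, 3])" for T
      unfolding SSYT[OF that] I bex_simps asc by auto
    show "l = l'" if "l \<in> {..<length descents_33}" "l' \<in> {..<length descents_33}" "?asc l T" "?asc l' T" for T l l'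
      using that unfolding I by (elim insertE emptyE; hypsubst; simp only: asc; linarith)
  qed (auto simp: descents_33_def nth_Cons split: nat.splits)
qed

lemma schur_222: "schur [2, 2, 2] = family_qf 6 {..<length descents_222} (\<lambda>l. set (descents_222 ! l))"
proof -
  define Ps :: "(nat \<times> nat) list list" where
    "Ps = [[(0,0), (0,1), (1,0), (1,1), (2,0), (2,1)],
      [(0,0), (1,0), (0,1), (1,1), (2,0), (2,1)],
      [(0,0), (1,0), (2,0), (0,1), (1,1), (2,1)],
      [(0,0), (0,1), (1,0), (2,0), (1,1), (2,1)],
      [(0,0), (1,0), (0,1), (2,0), (1,1), (2,1)]]"
  let ?asc = "\<lambda>l. ascending 6 (set (descents_222 ! l)) (\<lambda>j. Ps ! l ! (j - 1))"
  have I: "{..<length descents_222} = {0 :: nat, 1, 2, 3, 4}" by (auto simp: descents_222_def)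
  have J: "{1..6 - 1 :: nat} = {1, 2, 3, 4, 5}" by auto
  have cells: "cells [2, 2, 2] = {(0,0), (0,1), (1,0), (1,1), (2,0), (2,1)}"
    by (auto simp: cells_Cons cells_Nil numeral_eq_Suc lessThan_Suc)
  have SSYT: "is_SSYT [2, 2, 2] T \<longleftrightarrow>
      T (0,0) \<le> T (0,1) \<and> T (1,0) \<le> T (1,1) \<and> T (2,0) \<le> T (2,1) \<and> T (0,0) < T (1,0) \<and> T (0,1) < T (1,1) \<and> T (1,0) < T (2,0) \<and> T (1,1) < T (2,1)"
    if "T \<in> fillings (cells [2, 2, 2])" for T
    unfolding is_SSYT_fillings[OF that] cells by (auto simp: numeral_2_eq_2)
  have asc: "?asc 0 T \<longleftrightarrow> T (0,0) \<le> T (0,1) \<and> T (0,1) < T (1,0) \<and> T (1,0) \<le> T (1,1) \<and> T (1,1) < T (2,0) \<and> T (2,0) \<le> T (2,1)"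
    "?asc 1 T \<longleftrightarrow> T (0,0) < T (1,0) \<and> T (1,0) \<le> T (0,1) \<and> T (0,1) < T (1,1) \<and> T (1,1) < T (2,0) \<and> T (2,0) \<le> T (2,1)"
    "?asc 2 T \<longleftrightarrow> T (0,0) < T (1,0) \<and> T (1,0) < T (2,0) \<and> T (2,0) \<le> T (0,1) \<and> T (0,1) < T (1,1) \<and> T (1,1) < T (2,1)"
    "?asc 3 T \<longleftrightarrow> T (0,0) \<le> T (0,1) \<and> T (0,1) < T (1,0) \<and> T (1,0) < T (2,0) \<and> T (2,0) \<le> T (1,1) \<and> T (1,1) < T (2,1)"
    "?asc 4 T \<longleftrightarrow> T (0,0) < T (1,0) \<and> T (1,0) \<le> T (0,1) \<and> T (0,1) < T (2,0) \<and> T (2,0) \<le> T (1,1) \<and> T (1,1) < T (2,1)" for T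
    unfolding ascending_def J by (auto simp: descents_222_def Ps_def)
  show ?thesis
  proof (rule schur_eq_family_qf[where p = "\<lambda>l j. Ps ! l ! (j - 1)"])
    show "bij_betw (\<lambda>j. Ps ! l ! (j - 1)) {1..6} (cells [2, 2, 2])" if "l \<in> {..<length descents_222}" for l
    proof -
      have "distinct (Ps ! l)" "length (Ps ! l) = 6" "set (Ps ! l) = cells [2, 2, 2]"
        using that unfolding I cells by (auto simp: Ps_def)
      then show ?thesis using bij_betw_nth_pred[of "Ps ! l"] by simp
    qed
    show "is_SSYT [2, 2, 2] T \<longleftrightarrow> (\<exists>l\<in>{..<length descents_222}. ?asc l T)" if "T \<in> fillings (cells [2, 2, 2])" for T
      unfolding SSYT[OF that] I bex_simps asc by auto
    show "l = l'" if "l \<in> {..<length descents_222}" "l' \<in> {..<length descents_222}" "?asc l T" "?asc l' T" for T l l'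
      using that unfolding I by (elim insertE emptyE; hypsubst; simp only: asc; linarith)
  qed (auto simp: descents_222_def nth_Cons split: nat.splits)
qed

section \<open>Symmetric sets of permutations\<close>

text \<open>Makes the sum in \<open>schur_positive\<close> a genuine one; over an infinite index set
  it would be 0 by convention.\<close>

lemma finite_partitions: "finite {lam. is_partition n lam}"
proof (rule finite_subset)
  have "length lam \<le> sum_list lam" if "0 \<notin> set lam" for lam :: "nat list"
    using that by (induction lam) auto
  then show "{lam. is_partition n lam} \<subseteq> {lam. set lam \<subseteq> {..n} \<and> length lam \<le> n}"
    unfolding is_partition_def using member_le_sum_list by auto
  show "finite {lam. set lam \<subseteq> {..n} \<and> length lam \<le> n}" by (rule finite_lists_length_le) simp
qed

text \<open>Symmetry is part of \<open>schur_positive\<close>; it enters as a hypothesis and is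
  supplied for each shape from its descent family.\<close>

lemma schur_positive_schur:
  assumes "is_partition n lam" "symmetric_fn (schur lam)"
  shows "schur_positive n (schur lam)"
  unfolding schur_positive_def
proof (intro conjI exI allI)
  let ?c = "\<lambda>\<mu>. if \<mu> = lam then 1 else 0 :: int"
  fix \<alpha>
  have "(\<Sum>\<mu>\<in>{\<mu>. is_partition n \<mu>}. ?c \<mu> * schur \<mu> \<alpha>) = (\<Sum>\<mu>\<in>{\<mu>. is_partition n \<mu>}. if \<mu> = lam then schur \<mu> \<alpha> else 0)"
    by (rule sum.cong) auto
  also have "\<dots> = schur lam \<alpha>" using assms(1) finite_partitions by simp
  finally show "schur lam \<alpha> = (\<Sum>\<mu>\<in>{\<mu>. is_partition n \<mu>}. ?c \<mu> * schur \<mu> \<alpha>)" ..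
qed (use assms in auto)

lemma schur_positive_zero: "schur_positive n (\<lambda>_. 0)"
  unfolding schur_positive_def symmetric_fn_def by (auto intro!: exI[of _ "\<lambda>_. 0"])

lemma schur_positive_add:
  assumes "schur_positive n f" "schur_positive n g"
  shows "schur_positive n (\<lambda>\<alpha>. f \<alpha> + g \<alpha>)"
proof -
  obtain c where c: "\<forall>lam. 0 \<le> c lam" "\<And>\<alpha>. f \<alpha> = (\<Sum>lam\<in>{lam. is_partition n lam}. c lam * schur lam \<alpha>)"
    using assms(1) unfolding schur_positive_def by blast
  obtain c' where c': "\<forall>lam. 0 \<le> c' lam" "\<And>\<alpha>. g \<alpha> = (\<Sum>lam\<in>{lam. is_partition n lam}. c' lam * schur lam \<alpha>)"
    using assms(2) unfolding schur_positive_def by blast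
  show ?thesis unfolding schur_positive_def
  proof (intro conjI exI[of _ "\<lambda>lam. c lam + c' lam"] allI)
    show "symmetric_fn (\<lambda>\<alpha>. f \<alpha> + g \<alpha>)" using assms unfolding schur_positive_def symmetric_fn_def by simp
    show "0 \<le> c lam + c' lam" for lam using c(1) c'(1) by simp
    show "f \<alpha> + g \<alpha> = (\<Sum>lam\<in>{lam. is_partition n lam}. (c lam + c' lam) * schur lam \<alpha>)" for \<alpha>
      unfolding c(2) c'(2) by (simp add: distrib_right sum.distrib)
  qed
qed

lemma schur_positive_sum:
  assumes "finite S" "\<And>w. w \<in> S \<Longrightarrow> schur_positive n (f w)"
  shows "schur_positive n (\<lambda>\<alpha>. \<Sum>w\<in>S. f w \<alpha>)"
  using assms by (induction S) (auto simp: schur_positive_zero intro: schur_positive_add)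

lemma schur_positive_row:
  assumes "1 \<le> n"
  shows "schur_positive n (Fqs n {})"
proof -
  have "schur [n] = Fqs n {}" unfolding schur_row family_qf_def by simp
  moreover have "schur_positive n (schur [n])"
    by (rule schur_positive_schur) (use assms symmetric_row in \<open>auto simp: is_partition_def schur_row\<close>)
  ultimately show ?thesis by simp
qed

lemma schur_positive_column:
  assumes "1 \<le> n"
  shows "schur_positive n (Fqs n {1..<n})"
proof -
  have "schur (replicate n 1) = Fqs n {1..<n}" unfolding schur_column family_qf_def by simp
  moreover have "schur_positive n (schur (replicate n 1))"
  proof (rule schur_positive_schur)
    show "is_partition n (replicate n 1)" unfolding is_partition_def by (auto simp: sorted_wrt_iff_nth_less sum_list_replicate)
    show "symmetric_fn (schur (replicate n 1))" unfolding schur_column by (rule symmetric_column[OF assms])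
  qed
  ultimately show ?thesis by simp
qed

lemma schur_positive_hook:
  assumes "2 \<le> n"
  shows "schur_positive n (family_qf n {1..<n} (\<lambda>i. {i}))"
  unfolding schur_hook[OF assms, symmetric]
proof (rule schur_positive_schur)
  show "symmetric_fn (schur [n - 1, 1])" unfolding schur_hook[OF assms] using assms by (intro symmetric_hook) simp
qed (use assms in \<open>auto simp: is_partition_def\<close>)

lemma schur_positive_cohook:
  assumes "2 \<le> n"
  shows "schur_positive n (family_qf n {1..<n} (\<lambda>i. {1..<n} - {i}))"
  unfolding schur_cohook[OF assms, symmetric]
proof (rule schur_positive_schur)
  show "is_partition n (2 # replicate (n - 2) 1)" unfolding is_partition_def
    using assms by (auto simp: sorted_wrt_iff_nth_less sum_list_replicate nth_Cons split: nat.splits)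
  show "symmetric_fn (schur (2 # replicate (n - 2) 1))" unfolding schur_cohook[OF assms]
    using assms by (intro symmetric_cohook) simp
qed

lemma schur_positive_22: "schur_positive 4 (family_qf 4 {..<length descents_22} (\<lambda>l. set (descents_22 ! l)))"
  unfolding schur_22[symmetric]
  by (rule schur_positive_schur) (auto simp: is_partition_def schur_22 symmetric_22)

lemma schur_positive_33: "schur_positive 6 (family_qf 6 {..<length descents_33} (\<lambda>l. set (descents_33 ! l)))"
  unfolding schur_33[symmetric]
  by (rule schur_positive_schur) (auto simp: is_partition_def schur_33 symmetric_33)

lemma schur_positive_222: "schur_positive 6 (family_qf 6 {..<length descents_222} (\<lambda>l. set (descents_222 ! l)))"
  unfolding schur_222[symmetric]
  by (rule schur_positive_schur) (auto simp: is_partition_def schur_222 symmetric_222)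

section \<open>Sets of permutations listed by their descent sets\<close>

lemma inj_on_nth_if_sets:
  fixes Ds :: "nat list list"
  assumes "\<And>l. l < length Ds \<Longrightarrow> d (ps ! l) = set (Ds ! l)" "distinct Ds" "\<And>D. D \<in> set Ds \<Longrightarrow> sorted_wrt (<) D"
  shows "inj_on ((!) ps) {..<length Ds}"
proof (rule inj_onI)
  fix i j assume ij: "i \<in> {..<length Ds}" "j \<in> {..<length Ds}" "ps ! i = ps ! j"
  then have "set (Ds ! i) = set (Ds ! j)" using assms(1) by (metis lessThan_iff)
  moreover have "sorted_wrt (<) (Ds ! i)" "sorted_wrt (<) (Ds ! j)" using assms(3) ij by simp_all
  ultimately have "Ds ! i = Ds ! j" by (simp add: strict_sorted_equal)
  then show "i = j" using assms(2) ij by (simp add: nth_eq_iff_index_eq)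
qed

text \<open>Distinct descent sets keep the listed permutations distinct, so passing from the list to
  its set loses no term.\<close>

lemma family_qf_list:
  fixes Ds :: "nat list list"
  assumes len: "length ps = length Ds" and "\<And>l. l < length Ds \<Longrightarrow> d (ps ! l) = set (Ds ! l)"
    "distinct Ds" "\<And>D. D \<in> set Ds \<Longrightarrow> sorted_wrt (<) D"
  shows "family_qf n (set ps) d = family_qf n {..<length Ds} (\<lambda>l. set (Ds ! l))" "card (set ps) = length Ds"
proof -
  have inj: "inj_on ((!) ps) {..<length Ds}" by (rule inj_on_nth_if_sets[where d = d]) (use assms in auto)
  have set: "set ps = (!) ps ` {..<length Ds}" using len by (auto simp: set_conv_nth)
  show "family_qf n (set ps) d = family_qf n {..<length Ds} (\<lambda>l. set (Ds ! l))"
    unfolding family_qf_def set using assms(2) by (simp add: sum.reindex[OF inj])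
  show "card (set ps) = length Ds" unfolding set by (simp add: card_image[OF inj])
qed

section \<open>Descent sets of permutations\<close>

lemma Des_subset: "Des n w \<subseteq> {1..<n}"
  unfolding Des_def by auto

lemma finite_Sn: "finite (Sn n)"
  unfolding Sn_def by (simp add: finite_permutations)

lemma Qgen_family: "Qgen n S = family_qf n S (Des n)"
  unfolding Qgen_def family_qf_def ..

lemma Des_iota: "Des n (iota n) = {}"
  unfolding Des_def iota_def by auto

lemma Des_delta: "Des n (delta n) = {1..<n}"
  unfolding Des_def delta_def by auto

text \<open>Without descents the values increase, so \<open>i \<le> w i\<close> throughout, and a
  permutation of an initial segment with this property is the identity.\<close>

lemma iota_if_no_descents:
  assumes w: "w \<in> Sn n" and "Des n w = {}"
  shows "w = iota n"
proof -
  have p: "w permutes {1..n}" using w unfolding Sn_def by simp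
  have step: "w i < w (Suc i)" if "i \<in> {1..<n}" for i
  proof -
    have "i \<in> {1..n-1}" using that by auto
    moreover have "i \<notin> Des n w" using assms(2) by blast
    ultimately have "w i \<le> w (Suc i)" unfolding Des_def by auto
    moreover have "w i \<noteq> w (Suc i)" using permutes_inj[OF p] by (simp add: inj_eq)
    ultimately show ?thesis by simp
  qed
  have "i \<le> w i" if "1 \<le> i" "i \<le> n" for i
    using that
  proof (induction i rule: dec_induct)
    case base
    then show ?case using permutes_in_image[OF p, of 1] by simp
  next
    case (step i)
    then show ?case using \<open>\<And>i. i \<in> {1..<n} \<Longrightarrow> w i < w (Suc i)\<close>[of i] by simp
  qed
  then show ?thesis unfolding iota_def by (intro permutes_natset_ge[OF p]) auto
qed

lemma delta_permutes: "delta n permutes {1..n}"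
  by (rule bij_imp_permutes) (auto simp: delta_def intro!: bij_betw_byWitness[where f' = "delta n"])

text \<open>Composing with the involution \<open>delta n\<close> reverses the values and turns all
  descents into ascents, which reduces to the identity case.\<close>

lemma delta_if_all_descents:
  assumes w: "w \<in> Sn n" and "Des n w = {1..<n}"
  shows "w = delta n"
proof -
  have p: "w permutes {1..n}" using w unfolding Sn_def by simp
  have "delta n \<circ> w \<in> Sn n" unfolding Sn_def using permutes_compose[OF p delta_permutes] by simp
  moreover have "Des n (delta n \<circ> w) = {}"
  proof -
    have "delta n (w i) \<le> delta n (w (Suc i))" if i: "i \<in> {1..n-1}" for i
    proof -
      have "i \<in> {1..<n}" using i by auto
      then have "w (Suc i) < w i" using assms(2) unfolding Des_def by blast
      moreover have "i \<in> {1..n}" "Suc i \<in> {1..n}" using i by auto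
      then have "w i \<in> {1..n}" "w (Suc i) \<in> {1..n}" by (simp_all only: permutes_in_image[OF p])
      ultimately show ?thesis unfolding delta_def by auto
    qed
    then show ?thesis unfolding Des_def by (auto simp: not_less)
  qed
  ultimately have "delta n \<circ> w = id" using iota_if_no_descents unfolding iota_def by blast
  then have "delta n (w i) = i" for i by (metis comp_apply id_apply)
  moreover have "delta n (delta n j) = j" for j unfolding delta_def by auto
  ultimately have "w i = delta n i" for i by metis
  then show ?thesis by blast
qed

section \<open>The two implications between symmetry and the list\<close>

definition symmetric_shape :: "nat \<Rightarrow> (nat \<Rightarrow> nat) set \<Rightarrow> bool" where
  "symmetric_shape n S \<longleftrightarrow> S \<subseteq> {iota n, delta n}
            \<or> (\<exists>\<pi> :: nat \<Rightarrow> nat \<Rightarrow> nat. S = \<pi> ` {1..n-1} \<and> (\<forall>i\<in>{1..n-1}. \<pi> i \<in> Sn n) \<and>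
                 ((\<forall>i\<in>{1..n-1}. Des n (\<pi> i) = {i}) \<or>
                  (\<forall>i\<in>{1..n-1}. Des n (\<pi> i) = {1..n-1} - {i})))
            \<or> (n = 4 \<and> (\<exists>p1 p2. p1 \<in> Sn n \<and> p2 \<in> Sn n \<and>
                 Des n p1 = {1,3} \<and> Des n p2 = {2} \<and>
                 (S = {p1, p2} \<or> S = {p1, p2, iota n} \<or> S = {p1, p2, delta n})))
            \<or> (n = 6 \<and> (\<exists>p1 p2 p3 p4 p5. {p1, p2, p3, p4, p5} \<subseteq> Sn n \<and>
                 S = {p1, p2, p3, p4, p5} \<and>
                 ((Des n p1 = {1,3,5} \<and> Des n p2 = {2,5} \<and> Des n p3 = {3} \<and>
                   Des n p4 = {1,4} \<and> Des n p5 = {2,4}) \<or>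
                  (Des n p1 = {2,4} \<and> Des n p2 = {1,3,4} \<and> Des n p3 = {1,2,4,5} \<and>
                   Des n p4 = {2,3,5} \<and> Des n p5 = {1,3,5}))))"

text \<open>Within each nontrivial family the members match the standard tableaux of one shape
  through their descent sets; the identity and the reversal add the Schur functions of a row and a
  column.\<close>

lemma schur_positive_if_shape:
  assumes S: "S \<subseteq> Sn n" and card: "card S \<le> n - 1" and shape: "symmetric_shape n S"
  shows "schur_positive n (family_qf n S (Des n))"
proof -
  have fin: "finite S" using S finite_Sn finite_subset by blast
  show ?thesis
  proof (cases "2 \<le> n")
    case False
    \<comment> \<open>For n \<le> 1 the size bound leaves only the empty set.\<close>
    then have "S = {}" using card fin by simp
    then show ?thesis unfolding family_qf_def by (simp add: schur_positive_zero)
  next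
    case n: True
    have I: "{1..n-1} = {1..<n}" using n by auto
    have triv: "schur_positive n (Fqs n (Des n (iota n)))" "schur_positive n (Fqs n (Des n (delta n)))"
      unfolding Des_iota Des_delta using n schur_positive_row schur_positive_column by simp_all
    from shape consider
      (a) "S \<subseteq> {iota n, delta n}"
    | (b) "\<exists>\<pi>. S = \<pi> ` {1..<n} \<and> (\<forall>i\<in>{1..<n}. \<pi> i \<in> Sn n) \<and>
          ((\<forall>i\<in>{1..<n}. Des n (\<pi> i) = {i}) \<or> (\<forall>i\<in>{1..<n}. Des n (\<pi> i) = {1..<n} - {i}))"
    | (c) "n = 4" "\<exists>p1 p2. p1 \<in> Sn n \<and> p2 \<in> Sn n \<and> Des n p1 = {1,3} \<and> Des n p2 = {2} \<and>
          (S = {p1, p2} \<or> S = {p1, p2, iota n} \<or> S = {p1, p2, delta n})"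
    | (d) "n = 6" "\<exists>p1 p2 p3 p4 p5. {p1, p2, p3, p4, p5} \<subseteq> Sn n \<and> S = {p1, p2, p3, p4, p5} \<and>
          ((Des n p1 = {1,3,5} \<and> Des n p2 = {2,5} \<and> Des n p3 = {3} \<and> Des n p4 = {1,4} \<and> Des n p5 = {2,4}) \<or>
           (Des n p1 = {2,4} \<and> Des n p2 = {1,3,4} \<and> Des n p3 = {1,2,4,5} \<and> Des n p4 = {2,3,5} \<and> Des n p5 = {1,3,5}))"
      unfolding symmetric_shape_def I by satx
    then show ?thesis
    proof cases
      case a
      then show ?thesis unfolding family_qf_def using triv fin by (intro schur_positive_sum) auto
    next
      case b
      then obtain \<pi> where \<pi>: "S = \<pi> ` {1..<n}"
        "(\<forall>i\<in>{1..<n}. Des n (\<pi> i) = {i}) \<or> (\<forall>i\<in>{1..<n}. Des n (\<pi> i) = {1..<n} - {i})" by blast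
      obtain D where D: "D = (\<lambda>i. {i}) \<or> D = (\<lambda>i. {1..<n} - {i})" "\<And>i. i \<in> {1..<n} \<Longrightarrow> Des n (\<pi> i) = D i"
        using \<pi>(2)
      proof
        assume "\<forall>i\<in>{1..<n}. Des n (\<pi> i) = {i}"
        then show thesis by (intro that[of "\<lambda>i. {i}"]) auto
      next
        assume "\<forall>i\<in>{1..<n}. Des n (\<pi> i) = {1..<n} - {i}"
        then show thesis by (intro that[of "\<lambda>i. {1..<n} - {i}"]) auto
      qed
      have "inj_on D {1..<n}" using D(1) by (elim disjE) (auto simp: inj_on_def)
      then have inj: "inj_on \<pi> {1..<n}" using D(2) unfolding inj_on_def by metis
      have "family_qf n S (Des n) = family_qf n {1..<n} D"
        unfolding family_qf_def \<pi>(1) sum.reindex[OF inj] using D(2) by (intro ext sum.cong) auto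
      then show ?thesis using D(1) schur_positive_hook[OF n] schur_positive_cohook[OF n] by auto
    next
      case c
      then obtain p1 p2 X where c: "n = 4" "Des n p1 = {1,3}" "Des n p2 = {2}" "S = {p1, p2} \<union> X"
        "X = {} \<or> X = {iota n} \<or> X = {delta n}" by (elim exE conjE disjE) force+
      \<comment> \<open>\<open>p2\<close> comes first because \<open>descents_22\<close> begins with
        {2}.\<close>
      have "family_qf n (set [p2, p1]) (Des n) = family_qf n {..<length descents_22} (\<lambda>l. set (descents_22 ! l))"
        by (rule family_qf_list) (use c in \<open>auto simp: descents_22_def nth_Cons split: nat.splits\<close>)
      then have pos: "schur_positive n (family_qf n {p2, p1} (Des n))" using schur_positive_22 c(1) by simp
      have "{p2, p1} \<inter> X = {}"
      proof -
        have "Des n x = {} \<or> Des n x = {1..<n}" if "x \<in> X" for x using c(5) that Des_iota Des_delta by auto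
        moreover have "1 \<in> {1..<n}" "2 \<in> {1..<n}" using c(1) by auto
        moreover have "2 \<notin> Des n p1" "Des n p1 \<noteq> {}" "1 \<notin> Des n p2" "Des n p2 \<noteq> {}" unfolding c(2,3) by auto
        ultimately have "p1 \<notin> X" "p2 \<notin> X" by metis+
        then show ?thesis by blast
      qed
      moreover have "finite X" using c(5) by auto
      ultimately have "family_qf n S (Des n) \<alpha> = family_qf n {p2, p1} (Des n) \<alpha> + (\<Sum>w\<in>X. Fqs n (Des n w) \<alpha>)" for \<alpha>
        unfolding family_qf_def c(4) by (subst sum.union_disjoint[symmetric]) (auto simp: insert_commute)
      moreover have "schur_positive n (\<lambda>\<alpha>. \<Sum>w\<in>X. Fqs n (Des n w) \<alpha>)"
        by (rule schur_positive_sum) (use \<open>finite X\<close> c(5) triv in auto)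
      ultimately show ?thesis using schur_positive_add[OF pos] by presburger
    next
      case d
      then obtain p1 p2 p3 p4 p5 where S': "S = set [p1, p2, p3, p4, p5]" and
        "(Des n p1 = {1,3,5} \<and> Des n p2 = {2,5} \<and> Des n p3 = {3} \<and> Des n p4 = {1,4} \<and> Des n p5 = {2,4}) \<or>
         (Des n p1 = {2,4} \<and> Des n p2 = {1,3,4} \<and> Des n p3 = {1,2,4,5} \<and> Des n p4 = {2,3,5} \<and> Des n p5 = {1,3,5})"
        unfolding list.set by blast
      then have "family_qf n S (Des n) = family_qf n {..<length descents_33} (\<lambda>l. set (descents_33 ! l)) \<or>
        family_qf n S (Des n) = family_qf n {..<length descents_222} (\<lambda>l. set (descents_222 ! l))"
      proof (elim disjE conjE)
        assume "Des n p1 = {1,3,5}" "Des n p2 = {2,5}" "Des n p3 = {3}" "Des n p4 = {1,4}" "Des n p5 = {2,4}"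
        then have "family_qf n (set [p1, p2, p3, p4, p5]) (Des n) = family_qf n {..<length descents_33} (\<lambda>l. set (descents_33 ! l))"
          by (intro family_qf_list) (auto simp: descents_33_def nth_Cons split: nat.splits)
        then show ?thesis unfolding S' ..
      next
        assume "Des n p1 = {2,4}" "Des n p2 = {1,3,4}" "Des n p3 = {1,2,4,5}" "Des n p4 = {2,3,5}" "Des n p5 = {1,3,5}"
        then have "family_qf n (set [p1, p2, p3, p4, p5]) (Des n) = family_qf n {..<length descents_222} (\<lambda>l. set (descents_222 ! l))"
          by (intro family_qf_list) (auto simp: descents_222_def nth_Cons split: nat.splits)
        then show ?thesis unfolding S' by blast
      qed
      then show ?thesis using schur_positive_33 schur_positive_222 d(1) by auto
    qed
  qed
qed

text \<open>Members realising n - 1 distinct values already exhaust a set of at most n - 1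
  elements.\<close>

lemma eq_image_if_all_present:
  assumes fin: "finite S" and card: "card S \<le> n - 1" and ex: "\<And>i. i \<in> {1..<n} \<Longrightarrow> \<exists>w\<in>S. f w = D i" and inj: "inj_on D {1..<n}"
  shows "\<exists>\<pi>. S = \<pi> ` {1..<n} \<and> (\<forall>i\<in>{1..<n}. \<pi> i \<in> S \<and> f (\<pi> i) = D i)"
proof -
  obtain \<pi> where \<pi>: "\<And>i. i \<in> {1..<n} \<Longrightarrow> \<pi> i \<in> S \<and> f (\<pi> i) = D i" using ex by metis
  have "inj_on \<pi> {1..<n}" using \<pi> inj unfolding inj_on_def by metis
  then have "card (\<pi> ` {1..<n}) = n - 1" by (simp add: card_image)
  then have "\<pi> ` {1..<n} = S" using \<pi> fin card by (intro card_seteq) auto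
  then show ?thesis using \<pi> by blast
qed

text \<open>Removing the identity and the reversal, the only permutations with trivial descent sets,
  leaves a proper family to which the classification applies; the size bound then decides whether a
  trivial permutation can be added back.\<close>

lemma shape_if_symmetric:
  assumes S: "S \<subseteq> Sn n" and card: "card S \<le> n - 1" and sym: "symmetric_fn (family_qf n S (Des n))"
  shows "symmetric_shape n S"
proof (cases "2 \<le> n")
  case False
  then have "S = {}" using card finite_subset[OF S finite_Sn] by simp
  then show ?thesis unfolding symmetric_shape_def by simp
next
  case n: True
  have finS: "finite S" using S finite_Sn finite_subset by blast
  have I: "{1..n-1} = {1..<n}" using n by auto
  define S' where "S' = {w \<in> {w \<in> S. Des n w \<noteq> {}}. Des n w \<noteq> {1..<n}}"
  have "symfam n S (Des n)" by (rule symfam_if_symmetric[OF finS Des_subset sym])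
  then have "symfam n S' (Des n)" unfolding S'_def by (intro symfam_remove) auto
  then have "proper_symfam n S' (Des n)" unfolding proper_symfam_def S'_def by auto
  then interpret proper_symfam n S' "Des n" .
  have S'_sub: "S' \<subseteq> S" unfolding S'_def by blast
  have rest: "S - S' \<subseteq> {iota n, delta n}"
    using S iota_if_no_descents delta_if_all_descents unfolding S'_def by blast
  have card_le: "card S' \<le> card S" by (rule card_mono[OF finS S'_sub])
  have card': "card S' \<le> n - 1" using card_le card by simp
  consider (hook) "a {1} \<noteq> 0" | (cohook) "a ({1..<n} - {1}) \<noteq> 0" | (none) "a {1} = 0" "a ({1..<n} - {1}) = 0" by blast
  then show ?thesis
  proof cases
    case hook
    have "\<exists>w\<in>S. Des n w = {i}" if "i \<in> {1..<n}" for i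
      using a_pos[of "{i}"] all_singletons[OF n card' hook that] S'_sub by blast
    then obtain \<pi> where \<pi>: "S = \<pi> ` {1..<n}" "\<forall>i\<in>{1..<n}. \<pi> i \<in> S \<and> Des n (\<pi> i) = {i}"
      using eq_image_if_all_present[OF finS card, of "Des n" "\<lambda>i. {i}"] by auto
    then have "\<forall>i\<in>{1..<n}. \<pi> i \<in> Sn n" "\<forall>i\<in>{1..<n}. Des n (\<pi> i) = {i}" using S by auto
    then show ?thesis unfolding symmetric_shape_def I using \<pi>(1) by metis
  next
    case cohook
    interpret c: proper_symfam n S' "\<lambda>w. {1..<n} - Des n w" by (rule complement)
    have c1: "c.a {1} \<noteq> 0" using cohook dcount_complement[of "{1}"] n by simp
    have "\<exists>w\<in>S. Des n w = {1..<n} - {i}" if i: "i \<in> {1..<n}" for i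
    proof -
      obtain w where "w \<in> S'" "{1..<n} - Des n w = {i}"
        using c.a_pos[of "{i}"] c.all_singletons[OF n card' c1 i] by blast
      then show ?thesis using S'_sub Des_subset[of n w] by blast
    qed
    moreover have "inj_on (\<lambda>i. {1..<n} - {i}) {1..<n}" by (rule inj_onI) blast
    ultimately obtain \<pi> where \<pi>: "S = \<pi> ` {1..<n}" "\<forall>i\<in>{1..<n}. \<pi> i \<in> S \<and> Des n (\<pi> i) = {1..<n} - {i}"
      using eq_image_if_all_present[OF finS card, of "Des n" "\<lambda>i. {1..<n} - {i}"] by blast
    then have "\<forall>i\<in>{1..<n}. \<pi> i \<in> Sn n" "\<forall>i\<in>{1..<n}. Des n (\<pi> i) = {1..<n} - {i}" using S by auto
    then show ?thesis unfolding symmetric_shape_def I using \<pi>(1) by metis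
  next
    case none
    show ?thesis
    proof (cases "S' = {}")
      case True
      then show ?thesis using rest unfolding symmetric_shape_def by blast
    next
      case ne: False
      then have pos: "0 < card S'" using finS S'_sub by (metis card_gt_0_iff finite_subset)
      obtain w where w: "w \<in> S'" using ne by blast
      \<comment> \<open>For n = 2 there is no proper descent set; for n = 3 the two proper ones are
        {1} and {2}, both excluded in this case.\<close>
      have "n \<noteq> 2"
      proof
        assume "n = 2"
        then have J: "{1..<n} = {1}" by auto
        show False using proper[OF w] d_subset[OF w] unfolding J by blast
      qed
      moreover have "n \<noteq> 3"
      proof
        assume "n = 3"
        then have J: "{1..<n} = {1, 2}" by auto
        then have "{1..<n} - {1} = {2}" by auto
        then have "Des n w \<noteq> {1}" "Des n w \<noteq> {2}" using a_0D[OF none(1) w] a_0D[OF none(2) w] by simp_all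
        then show False using proper[OF w] d_subset[OF w] unfolding J by blast
      qed
      moreover have "\<not> (5 \<le> n \<and> n \<noteq> 6)"
        using empty_if_small[OF _ proper_symfam_axioms none card'] ne by blast
      ultimately consider (4) "n = 4" | (6) "n = 6" using n by linarith
      then show ?thesis
      proof cases
        case 4
        \<comment> \<open>The size is twice the multiplicity of {2} and lies between 1 and 3, so the
          multiplicity is 1 and there is room for one more permutation.\<close>
        have a2: "a {2} = 1" "card S' = 2" "a {1, 3} = 1"
          using counts4[OF 4 none] pos card' 4 by auto
        obtain p1 p2 where p: "p1 \<in> S'" "Des n p1 = {1, 3}" "p2 \<in> S'" "Des n p2 = {2}"
          using a_pos[of "{1, 3}"] a_pos[of "{2}"] a2 by auto
        have "p1 \<noteq> p2" using p(2,4) by auto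
        then have "card {p1, p2} = 2" by simp
        then have S': "S' = {p1, p2}" using p a2(2) finS S'_sub
          by (metis card_subset_eq empty_subsetI finite_subset insert_subset)
        have "card (S - S') \<le> 1"
          using card_Diff_subset[OF finite_subset[OF S'_sub finS] S'_sub] a2(2) card 4 by simp
        then have "S - S' = {} \<or> S - S' = {iota n} \<or> S - S' = {delta n}"
        proof -
          have "\<not> (iota n \<in> S - S' \<and> delta n \<in> S - S')"
          proof
            assume a: "iota n \<in> S - S' \<and> delta n \<in> S - S'"
            have "Des n (iota n) \<noteq> Des n (delta n)" unfolding Des_iota Des_delta using n by auto
            then have "iota n \<noteq> delta n" by metis
            then have "2 \<le> card (S - S')" using a finS card_mono[of "S - S'" "{iota n, delta n}"] by simp
            then show False using \<open>card (S - S') \<le> 1\<close> by simp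
          qed
          then show ?thesis using rest by blast
        qed
        moreover have "S = S' \<union> (S - S')" using S'_sub by blast
        ultimately have "S = {p1, p2} \<or> S = {p1, p2, iota n} \<or> S = {p1, p2, delta n}" unfolding S' by (elim disjE) auto
        moreover have "p1 \<in> Sn n" "p2 \<in> Sn n" using p S'_sub S by auto
        ultimately have ex: "\<exists>p1 p2. p1 \<in> Sn n \<and> p2 \<in> Sn n \<and> Des n p1 = {1,3} \<and> Des n p2 = {2} \<and>
            (S = {p1, p2} \<or> S = {p1, p2, iota n} \<or> S = {p1, p2, delta n})"
          using p(2,4) by (intro exI[of _ p1] exI[of _ p2] conjI)
        show ?thesis unfolding symmetric_shape_def by (rule disjI2[OF disjI2[OF disjI1[OF conjI[OF 4 ex]]]])
      next
        case 6
        have card5: "card S' = 5" using counts6(1)[OF 6 none] card' 6 ne by simp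
        \<comment> \<open>Five members already reach the bound at n = 6, so no trivial permutation
          fits.\<close>
        then have "S' = S" using card 6 finS S'_sub card_le by (intro card_seteq) auto
        have all: "S = set ps" if len: "length ps = 5" "length Ds = 5" "set ps \<subseteq> S" and "\<And>l. l < length Ds \<Longrightarrow> Des n (ps ! l) = set (Ds ! l)"
          "distinct Ds" "\<And>D. D \<in> set Ds \<Longrightarrow> sorted_wrt (<) D" for ps Ds
        proof -
          have "card (set ps) = 5" using family_qf_list(2)[of ps Ds "Des n"] that by simp
          then show ?thesis using card5 \<open>S' = S\<close> finS len(3) by (metis card_subset_eq)
        qed
        have pick: "\<exists>w\<in>S. Des n w = D" if "0 < a D" for D using a_pos[OF that] S'_sub by blast
        from counts6(2)[OF 6 none _ ne] card' 6
        consider "0 < a {1, 3, 5}" "0 < a {2, 5}" "0 < a {3}" "0 < a {1, 4}" "0 < a {2, 4}"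
          | "0 < a {2, 4}" "0 < a {1, 3, 4}" "0 < a {1, 2, 4, 5}" "0 < a {2, 3, 5}" "0 < a {1, 3, 5}"
          by auto
        then show ?thesis
        proof cases
          case 1
          obtain p1 where p1: "p1 \<in> S" "Des n p1 = {1,3,5}" using pick[OF 1(1)] by blast
          obtain p2 where p2: "p2 \<in> S" "Des n p2 = {2,5}" using pick[OF 1(2)] by blast
          obtain p3 where p3: "p3 \<in> S" "Des n p3 = {3}" using pick[OF 1(3)] by blast
          obtain p4 where p4: "p4 \<in> S" "Des n p4 = {1,4}" using pick[OF 1(4)] by blast
          obtain p5 where p5: "p5 \<in> S" "Des n p5 = {2,4}" using pick[OF 1(5)] by blast
          note p = p1(1) p2(1) p3(1) p4(1) p5(1) p1(2) p2(2) p3(2) p4(2) p5(2)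
          have "S = set [p1, p2, p3, p4, p5]"
            by (rule all[of _ descents_33]) (use p in \<open>auto simp: descents_33_def nth_Cons split: nat.splits\<close>)
          then have "{p1, p2, p3, p4, p5} \<subseteq> Sn n \<and> S = {p1, p2, p3, p4, p5}" using p(1-5) S by auto
          then show ?thesis unfolding symmetric_shape_def using p(6-10) 6 by metis
        next
          case 2
          obtain p1 where p1: "p1 \<in> S" "Des n p1 = {2,4}" using pick[OF 2(1)] by blast
          obtain p2 where p2: "p2 \<in> S" "Des n p2 = {1,3,4}" using pick[OF 2(2)] by blast
          obtain p3 where p3: "p3 \<in> S" "Des n p3 = {1,2,4,5}" using pick[OF 2(3)] by blast
          obtain p4 where p4: "p4 \<in> S" "Des n p4 = {2,3,5}" using pick[OF 2(4)] by blast
          obtain p5 where p5: "p5 \<in> S" "Des n p5 = {1,3,5}" using pick[OF 2(5)] by blast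
          note p = p1(1) p2(1) p3(1) p4(1) p5(1) p1(2) p2(2) p3(2) p4(2) p5(2)
          have "S = set [p1, p2, p3, p4, p5]"
            by (rule all[of _ descents_222]) (use p in \<open>auto simp: descents_222_def nth_Cons split: nat.splits\<close>)
          then have "{p1, p2, p3, p4, p5} \<subseteq> Sn n \<and> S = {p1, p2, p3, p4, p5}" using p(1-5) S by auto
          then show ?thesis unfolding symmetric_shape_def using p(6-10) 6 by metis
        qed
      qed
    qed
  qed
qed

theorem theorem1p3:
  fixes n :: nat and S :: "(nat \<Rightarrow> nat) set"
  assumes "S \<subseteq> Sn n" and "card S \<le> n - 1"
  shows "(symmetric_fn (Qgen n S) \<longleftrightarrow>
           (S \<subseteq> {iota n, delta n}
            \<or> (\<exists>\<pi> :: nat \<Rightarrow> nat \<Rightarrow> nat. S = \<pi> ` {1..n-1} \<and> (\<forall>i\<in>{1..n-1}. \<pi> i \<in> Sn n) \<and>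
                 ((\<forall>i\<in>{1..n-1}. Des n (\<pi> i) = {i}) \<or>
                  (\<forall>i\<in>{1..n-1}. Des n (\<pi> i) = {1..n-1} - {i})))
            \<or> (n = 4 \<and> (\<exists>p1 p2. p1 \<in> Sn n \<and> p2 \<in> Sn n \<and>
                 Des n p1 = {1,3} \<and> Des n p2 = {2} \<and>
                 (S = {p1, p2} \<or> S = {p1, p2, iota n} \<or> S = {p1, p2, delta n})))
            \<or> (n = 6 \<and> (\<exists>p1 p2 p3 p4 p5. {p1, p2, p3, p4, p5} \<subseteq> Sn n \<and>
                 S = {p1, p2, p3, p4, p5} \<and>
                 ((Des n p1 = {1,3,5} \<and> Des n p2 = {2,5} \<and> Des n p3 = {3} \<and>
                   Des n p4 = {1,4} \<and> Des n p5 = {2,4}) \<or>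
                  (Des n p1 = {2,4} \<and> Des n p2 = {1,3,4} \<and> Des n p3 = {1,2,4,5} \<and>
                   Des n p4 = {2,3,5} \<and> Des n p5 = {1,3,5}))))))
         \<and> (symmetric_fn (Qgen n S) \<longleftrightarrow> schur_positive n (Qgen n S))"
proof -
  \<comment> \<open>Symmetry yields the list, the list yields Schur-positivity, and Schur-positivity
    contains symmetry by definition.\<close>
  have "symmetric_fn (Qgen n S) \<longleftrightarrow> symmetric_shape n S" "symmetric_fn (Qgen n S) \<longleftrightarrow> schur_positive n (Qgen n S)"
    using shape_if_symmetric[OF assms] schur_positive_if_shape[OF assms]
    unfolding Qgen_family schur_positive_def by blast+
  then show ?thesis unfolding symmetric_shape_def by blast
qed

end
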